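(* Let $\gamma\ge 1$, $K,\lambda,\mu,\nu>0$, $p(\rho)=K\rho^\gamma$, $\rho_+>0$, $u_+<0$, $u_b<0$, $\omega_b\neq 0$, and $\omega_+=0$. Consider on $\mathbb{R}_+=(0,\infty)$ the stationary boundary value problem $$(\tilde\rho\tilde u)_x=0,\qquad (\tilde\rho\tilde u^2)_x+p(\tilde\rho)_x=\lambda\tilde u_{xx},\qquad (\tilde\rho\tilde u\tilde\omega)_x+\mu\tilde\omega=\nu\tilde\omega_{xx},$$ $$\inf_{x\in\mathbb{R}_+}\tilde\rho(x)>0,\quad \lim_{x\to\infty}(\tilde\rho,\tilde u,\tilde\omega)(x)=(\rho_+,u_+,0),\quad \tilde u(0)=u_b,\quad \tilde\omega(0)=\omega_b .$$ This problem has a unique smooth solution $(\tilde\rho,\tilde u,\tilde\omega)$ if and only if $M_+\ge 1$ and $\chi_c u_+>u_b$. Moreover, with $\tilde\delta=\max\{|\omega_b|,|u_b-u_+|\}$: (i) If $M_+>1$, then the solution satisfies, for $k=0,1,2,\dots$ and $x>0$, $$|\partial_x^k(\tilde\rho-\rho_+,\tilde u-u_+,\tilde\omega-\omega_+)|\le C\tilde\delta e^{-\sigma x},$$ where $C$ and $\sigma$ are positive constants. (ii) If $M_+=1$, then the solution satisfies, for $k=0,1,2,\dots$ and $x>0$, $$|\partial_x^k(\tilde\rho-\rho_+,\tilde u-u_+)|\le C\frac{\tilde\delta^{k+1}}{(1+\tilde\delta x)^{k+1}},\qquad |\partial_x^k(\tilde\omega-\omega_+)|\le C\tilde\delta e^{-\sigma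 x},$$ where $C$ and $\sigma$ are positive constants. (In both parts $\sigma$ does not depend on $k$ or $x$, and $C$ does not depend on $x$ but may depend on $k$.)
   Context: The Mach number at the far field is $M_+=|u_+|/c_+$ with sound speed $c_+=\sqrt{p'(\rho_+)}=\sqrt{K\gamma\rho_+^{\gamma-1}}$. Define, for $\chi>0$, $F(\chi)=K\rho_+^\gamma(\chi^{-\gamma}-1)+\rho_+u_+^2(\chi-1)$. If $M_+>1$, the equation $F(\chi)=0$ has exactly two distinct positive roots, $\chi=1$ and $\chi=\chi_c$; this defines $\chi_c$. If $M_+=1$, the only root is $\chi=1$ and one sets $\chi_c=1$.
   Formalization: Adds the hypothesis that M_+>1 or u_b≠u_+; when M_+≤1 and u_b=u_+, the constant state (ρ_+,u_+) with ω a decaying exponential is the unique smooth solution, although the condition M_+≥1 and χ_c u_+>u_b fails. *)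

theory Defs
  imports "HOL-Analysis.Analysis"
begin

definition pressure :: "real \<Rightarrow> real \<Rightarrow> real \<Rightarrow> real" where
  "pressure K \<gamma> r = K * r powr \<gamma>"

definition sound_speed :: "real \<Rightarrow> real \<Rightarrow> real \<Rightarrow> real" where
  "sound_speed K \<gamma> r = sqrt (deriv (pressure K \<gamma>) r)"

definition mach :: "real \<Rightarrow> real \<Rightarrow> real \<Rightarrow> real \<Rightarrow> real" where
  "mach K \<gamma> \<rho>p up = \<bar>up\<bar> / sound_speed K \<gamma> \<rho>p"

definition F :: "real \<Rightarrow> real \<Rightarrow> real \<Rightarrow> real \<Rightarrow> real \<Rightarrow> real" where
  "F K \<gamma> \<rho>p up r =
     K * \<rho>p powr \<gamma> * (r powr (- \<gamma>) - 1) + \<rho>p * up\<^sup>2 * (r - 1)"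

text \<open>Only far-field Mach numbers at least 1 are meaningful here; the value 1 returned in the
  subsonic case is a dummy. The description is well defined in the supersonic case by
  \<open>chi_c_roots\<close> below.\<close>

definition chi_c :: "real \<Rightarrow> real \<Rightarrow> real \<Rightarrow> real \<Rightarrow> real" where
  "chi_c K \<gamma> \<rho>p up =
     (if mach K \<gamma> \<rho>p up > 1
      then THE r. r > 0 \<and> r \<noteq> 1 \<and> F K \<gamma> \<rho>p up r = 0
      else 1)"

text \<open>Classical smoothness: continuous up to the boundary point \<open>0\<close> and infinitely
  differentiable on the open half line, where \<open>deriv\<close> does not see the values of \<open>f\<close>
  outside it.\<close>

definition smooth_half_line :: "(real \<Rightarrow> real) \<Rightarrow> bool" where
  "smooth_half_line f \<longleftrightarrow>
     continuous_on {0..} f \<and> (\<forall>k. (deriv ^^ k) f differentiable_on {0<..})"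

text \<open>Functions on the closed half line are represented by functions on all reals, whose values
  on the negative reals are irrelevant. Boundary values are attained continuously, by the
  continuity on \<open>{0..}\<close> contained in \<open>smooth_half_line\<close>. The conjunct \<open>bdd_below\<close> is
  needed because \<open>Inf\<close> on the reals is unspecified for sets that are not bounded below.
  The far-field value of the microrotation is \<open>\<omega>p\<close>.\<close>

definition stationary_solution ::
  "real \<Rightarrow> real \<Rightarrow> real \<Rightarrow> real \<Rightarrow> real \<Rightarrow> real \<Rightarrow> real \<Rightarrow> real \<Rightarrow> real \<Rightarrow> real
    \<Rightarrow> (real \<Rightarrow> real) \<Rightarrow> (real \<Rightarrow> real) \<Rightarrow> (real \<Rightarrow> real) \<Rightarrow> bool" where
  "stationary_solution K \<gamma> lam \<mu> \<nu> \<rho>p up \<omega>p ub \<omega>b \<rho> u \<omega> \<longleftrightarrow>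
     smooth_half_line \<rho> \<and> smooth_half_line u \<and> smooth_half_line \<omega> \<and>
     (\<forall>x>0. deriv (\<lambda>y. \<rho> y * u y) x = 0) \<and>
     (\<forall>x>0. deriv (\<lambda>y. \<rho> y * (u y)\<^sup>2) x + deriv (\<lambda>y. pressure K \<gamma> (\<rho> y)) x
              = lam * deriv (deriv u) x) \<and>
     (\<forall>x>0. deriv (\<lambda>y. \<rho> y * u y * \<omega> y) x + \<mu> * \<omega> x = \<nu> * deriv (deriv \<omega>) x) \<and>
     bdd_below (\<rho> ` {0<..}) \<and> (INF x\<in>{0<..}. \<rho> x) > 0 \<and>
     (\<rho> \<longlongrightarrow> \<rho>p) at_top \<and> (u \<longlongrightarrow> up) at_top \<and> (\<omega> \<longlongrightarrow> \<omega>p) at_top \<and>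
     u 0 = ub \<and> \<omega> 0 = \<omega>b"

lemma sound_speed_eq:
  assumes "r > 0"
  shows "sound_speed K \<gamma> r = sqrt (K * \<gamma> * r powr (\<gamma> - 1))"
proof -
  have "(pressure K \<gamma> has_real_derivative K * (\<gamma> * r powr (\<gamma> - 1))) (at r)"
    unfolding pressure_def
    by (intro DERIV_cmult has_real_derivative_powr assms)
  then show ?thesis
    by (simp add: sound_speed_def DERIV_imp_deriv mult.assoc)
qed

lemma F_has_derivative:
  assumes "r > 0"
  shows "(F K \<gamma> \<rho>p up has_real_derivative
            (\<rho>p * up\<^sup>2 - \<gamma> * K * \<rho>p powr \<gamma> * r powr (- \<gamma> - 1))) (at r)"
  unfolding F_def
  by (rule derivative_eq_intros has_real_derivative_powr[OF assms] refl | simp)+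

lemma supersonic_iff:
  assumes "\<gamma> \<ge> 1" "K > 0" "\<rho>p > 0"
  shows "mach K \<gamma> \<rho>p up > 1 \<longleftrightarrow> \<rho>p * up\<^sup>2 > \<gamma> * K * \<rho>p powr \<gamma>"
proof -
  have pos: "K * \<gamma> * \<rho>p powr (\<gamma> - 1) > 0"
    using assms by simp
  then have "mach K \<gamma> \<rho>p up > 1 \<longleftrightarrow> sqrt (K * \<gamma> * \<rho>p powr (\<gamma> - 1)) < sqrt (up\<^sup>2)"
    by (simp add: mach_def sound_speed_eq[OF assms(3)] less_divide_eq del: real_sqrt_mult)
  also have "\<dots> \<longleftrightarrow> \<rho>p * (K * \<gamma> * \<rho>p powr (\<gamma> - 1)) < \<rho>p * up\<^sup>2"
    using assms(3) by (simp add: mult.assoc del: real_sqrt_abs)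
  also have "\<rho>p * (K * \<gamma> * \<rho>p powr (\<gamma> - 1)) = \<gamma> * K * \<rho>p powr \<gamma>"
    using assms(3) by (simp add: powr_diff)
  finally show ?thesis .
qed

lemma F_three_roots:
  assumes "\<gamma> \<ge> 1" "K > 0" "\<rho>p > 0" "0 < a" "a < b" "b < c"
    and "F K \<gamma> \<rho>p up a = 0" "F K \<gamma> \<rho>p up b = 0" "F K \<gamma> \<rho>p up c = 0"
  shows False
proof -
  let ?D = "\<lambda>r. \<rho>p * up\<^sup>2 - \<gamma> * K * \<rho>p powr \<gamma> * r powr (- \<gamma> - 1)"
  have *: "\<exists>z. s < z \<and> z < t \<and> ?D z = 0"
    if "0 < s" "s < t" "F K \<gamma> \<rho>p up s = 0" "F K \<gamma> \<rho>p up t = 0" for s t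
  proof -
    have "\<exists>z. s < z \<and> z < t \<and> F K \<gamma> \<rho>p up t - F K \<gamma> \<rho>p up s = (t - s) * ?D z"
      using that by (intro MVT2 F_has_derivative) auto
    then show ?thesis
      using that by force
  qed
  from *[of a b] obtain y where y: "a < y" "y < b" "?D y = 0" using assms by auto
  from *[of b c] obtain z where z: "b < z" "z < c" "?D z = 0" using assms by auto
  have "z powr (- \<gamma> - 1) < y powr (- \<gamma> - 1)"
    using y z assms by (intro powr_less_mono2_neg) auto
  moreover have "\<gamma> * K * \<rho>p powr \<gamma> > 0"
    using assms by simp
  ultimately have "?D y < ?D z"
    by (smt (verit) mult_strict_left_mono)
  then show False using y z by simp
qed

lemma chi_c_roots:
  assumes "\<gamma> \<ge> 1" "K > 0" "\<rho>p > 0" and super: "mach K \<gamma> \<rho>p up > 1"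
  shows "chi_c K \<gamma> \<rho>p up \<noteq> 1"
    and "{r. r > 0 \<and> F K \<gamma> \<rho>p up r = 0} = {1, chi_c K \<gamma> \<rho>p up}"
proof -
  let ?F = "F K \<gamma> \<rho>p up"
  let ?P = "\<lambda>r. r > 0 \<and> r \<noteq> 1 \<and> ?F r = 0"
  define A where "A = K * \<rho>p powr \<gamma>"
  define B where "B = \<rho>p * up\<^sup>2"
  have A: "A > 0" using assms by (simp add: A_def)
  have AB: "\<gamma> * A < B"
    using supersonic_iff[of \<gamma> K \<rho>p up] assms by (simp add: A_def B_def mult.assoc)
  then have B: "B > 0" using A assms(1) by (smt (verit) mult_pos_pos)
  have F1: "?F 1 = 0" by (simp add: F_def)
  have "(?F has_real_derivative B - \<gamma> * A) (at 1)"
    using F_has_derivative[of 1 K \<gamma> \<rho>p up] by (simp add: A_def B_def mult.assoc)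
  then obtain d where d: "d > 0" "\<And>h. 0 < h \<Longrightarrow> h < d \<Longrightarrow> ?F (1 - h) < 0"
    using DERIV_pos_inc_left[of ?F "B - \<gamma> * A" 1] AB F1 by auto
  define s where "s = (1 + B / A) powr (- 1 / \<gamma>)"
  have BA: "1 + B / A > 1" using A B by simp
  then have "1 + B / A \<noteq> 0" by linarith
  then have s: "0 < s" "s < 1"
    using powr_less_mono[of "- 1 / \<gamma>" 0 "1 + B / A"] BA assms(1) by (auto simp: s_def)
  have "s powr (- \<gamma>) = 1 + B / A"
    using assms(1) BA by (simp add: s_def powr_powr)
  then have "?F s = B * s"
    using A by (simp add: F_def flip: A_def B_def) (simp add: algebra_simps)
  then have Fs: "?F s > 0" using B s by simp
  define h where "h = min (d / 2) ((1 - s) / 2)"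
  have h: "0 < h" "h < d" "s < 1 - h"
    using d s by (auto simp: h_def min_def field_simps)
  have "\<exists>x\<ge>s. x \<le> 1 - h \<and> ?F x = 0"
    using Fs d(2)[OF h(1,2)] h s
    by (intro IVT2) (auto intro!: DERIV_isCont F_has_derivative)
  then obtain x where "s \<le> x" "x \<le> 1 - h" "?F x = 0" by blast
  then have x: "?P x"
    using s h by auto
  have x1: "x < 1" using \<open>x \<le> 1 - h\<close> h(1) by linarith
  note three = F_three_roots[OF assms(1-3), where up = up]
  have uniq: "y = x" if "?P y" for y
  proof (rule ccontr)
    assume "y \<noteq> x"
    with that x1 consider "y < x" | "x < y" "y < 1" | "1 < y" by linarith
    then show False
    proof cases
      case 1
      show ?thesis by (rule three[of y x 1]) (use 1 that x x1 F1 in simp_all)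
    next
      case 2
      show ?thesis by (rule three[of x y 1]) (use 2 that x F1 in simp_all)
    next
      case 3
      show ?thesis by (rule three[of x 1 y]) (use 3 that x x1 F1 in simp_all)
    qed
  qed
  have eq: "chi_c K \<gamma> \<rho>p up = x"
    unfolding chi_c_def if_P[OF super] by (rule the_equality) (fact x, fact uniq)
  show "chi_c K \<gamma> \<rho>p up \<noteq> 1"
    using x eq by blast
  have "{r. r > 0 \<and> ?F r = 0} \<subseteq> {1, x}"
    using uniq by blast
  moreover have "{1, x} \<subseteq> {r. r > 0 \<and> ?F r = 0}"
    using x F1 by simp
  ultimately show "{r. r > 0 \<and> ?F r = 0} = {1, chi_c K \<gamma> \<rho>p up}"
    unfolding eq by (rule equalityI)
qed

end

theory Submission
  imports Defs
begin

text \<open>The flux \<open>\<rho> u\<close> is constant, so in the variable \<open>v = u / u\<^sub>+\<close> the problem for \<open>(\<rho>, u)\<close> reduces to the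
  scalar equation \<open>v' = F(v) / (\<lambda> u\<^sub>+)\<close> with \<open>v \<rightarrow> 1\<close>, and the problem for \<open>\<omega>\<close> to a linear equation
  with constant coefficients and exactly one decaying exponential. Since \<open>F\<close> is convex on the
  positive half line, the basin of attraction of the equilibrium \<open>1\<close> is \<open>(\<chi>\<^sub>c, \<infinity>)\<close> if \<open>M\<^sub>+ > 1\<close>,
  \<open>[1, \<infinity>)\<close> if \<open>M\<^sub>+ = 1\<close>, and \<open>{1}\<close> if \<open>M\<^sub>+ < 1\<close>. A time derivative of \<open>h(v)\<close> is \<open>h'(v)\<close> times the
  vector field, so each differentiation preserves the order of vanishing at \<open>1\<close> when the zero of \<open>F\<close>
  there is simple and raises it by one when it is double.\<close>

section \<open>Iterated derivatives\<close>

text \<open>Since \<open>u\<^sub>+ < 0\<close>, the reduced field has the sign opposite to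
  \<open>F\<close>; a positive slope of \<open>F\<close> at 1, that is supersonic flow, therefore
  makes 1 attracting. If the Mach number is at most 1 and \<open>ub = up\<close>, constant density
  and velocity with a decaying microrotation solve the problem although the stated condition fails
  (the strict inequality at Mach number 1, the bound on the Mach number below it). The hypothesis
  \<open>nondegenerate\<close> excludes exactly this case. The obstacle to existence is that
  \<open>F\<close> is singular at 0 and the solution must live for all times. The logarithm of the
  distance to the equilibrium obeys an equation with a bounded positive field, which settles global
  existence and convergence together. Uniqueness is used in both time directions: backwards it shows
  that no orbit reaches an equilibrium in finite time, which gives the necessity of the conditions.
  The constants of the decay estimates are chosen after the data, so the powers of
  \<open>\<delta>\<close> come from rescaling them.\<close>

lemma deriv_cong_on:
  assumes "open S" "x \<in> S" "\<And>y. y \<in> S \<Longrightarrow> f y = g y"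
  shows "deriv f x = deriv g x"
proof (rule deriv_cong_ev)
  show "\<forall>\<^sub>F y in nhds x. f y = g y"
    using assms eventually_nhds by blast
qed simp

lemma DERIV_cong_on:
  assumes "open S" "x \<in> S" "\<And>y. y \<in> S \<Longrightarrow> f y = g y" "DERIV g x :> d"
  shows "DERIV f x :> d"
proof -
  have "\<forall>\<^sub>F y in nhds x. f y = g y"
    using assms eventually_nhds by blast
  then show ?thesis
    using assms(4) DERIV_cong_ev[of x x f g d d] by simp
qed

lemma higher_deriv_Suc: "(deriv ^^ Suc k) f = (deriv ^^ k) (deriv f)"
  by (simp add: funpow_swap1)

lemma higher_deriv_cong_on:
  assumes "open S" "x \<in> S" "\<And>y. y \<in> S \<Longrightarrow> f y = g y"
  shows "(deriv ^^ k) f x = (deriv ^^ k) g x"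
  using assms(3)
proof (induction k arbitrary: f g)
  case 0
  then show ?case using assms by simp
next
  case (Suc k)
  have "deriv f y = deriv g y" if "y \<in> S" for y
    using that Suc.prems by (intro deriv_cong_on[OF assms(1)])
  then show ?case
    unfolding higher_deriv_Suc by (intro Suc.IH)
qed

lemma differentiable_on_DERIV:
  fixes f :: "real \<Rightarrow> real"
  assumes "open S" "f differentiable_on S" "x \<in> S"
  shows "DERIV f x :> deriv f x"
  using assms
  by (metis DERIV_deriv_iff_real_differentiable at_within_open differentiable_on_def)

lemma DERIV_differentiable_on:
  fixes f :: "real \<Rightarrow> real"
  assumes "\<And>x. x \<in> S \<Longrightarrow> DERIV f x :> f' x"
  shows "f differentiable_on S"
  unfolding differentiable_on_def
  by (meson assms differentiable_at_withinI real_differentiable_def)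

text \<open>The order \<open>n\<close> is a counter for induction: one derivative of a product is a
  sum of products of functions that are smooth to one order less.\<close>

definition smooth_upto :: "nat \<Rightarrow> real set \<Rightarrow> (real \<Rightarrow> real) \<Rightarrow> bool" where
  "smooth_upto n S f \<longleftrightarrow> (\<forall>k<n. (deriv ^^ k) f differentiable_on S)"

definition smooth_on :: "real set \<Rightarrow> (real \<Rightarrow> real) \<Rightarrow> bool" where
  "smooth_on S f \<longleftrightarrow> (\<forall>k. (deriv ^^ k) f differentiable_on S)"

lemma smooth_on_iff_upto: "smooth_on S f \<longleftrightarrow> (\<forall>n. smooth_upto n S f)"
  unfolding smooth_on_def smooth_upto_def by blast

lemma smooth_upto_0: "smooth_upto 0 S f"
  by (simp add: smooth_upto_def)

lemma smooth_upto_Suc: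
  "smooth_upto (Suc n) S f \<longleftrightarrow> f differentiable_on S \<and> smooth_upto n S (deriv f)"
  unfolding smooth_upto_def All_less_Suc2 higher_deriv_Suc by simp

lemma smooth_upto_mono: "smooth_upto n S f \<Longrightarrow> m \<le> n \<Longrightarrow> smooth_upto m S f"
  by (auto simp: smooth_upto_def)

text \<open>\<open>g\<close> may differ from \<open>deriv f\<close> outside \<open>S\<close>.
  Because \<open>S\<close> is open, the iterated derivatives at points of \<open>S\<close> do not
  see this.\<close>

lemma smooth_upto_Suc_DERIV:
  assumes "open S" "\<And>x. x \<in> S \<Longrightarrow> DERIV f x :> g x" "smooth_upto n S g"
  shows "smooth_upto (Suc n) S f"
  unfolding smooth_upto_def
proof (intro allI impI)
  fix k assume "k < Suc n"
  have f: "f differentiable_on S"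
    by (rule DERIV_differentiable_on) (rule assms(2))
  show "(deriv ^^ k) f differentiable_on S"
  proof (cases k)
    case 0
    then show ?thesis using f by simp
  next
    case (Suc j)
    with \<open>k < Suc n\<close> have j: "j < n" by simp
    have "(deriv ^^ j) g differentiable_on S"
      using assms(3) j by (simp add: smooth_upto_def)
    then have g: "DERIV ((deriv ^^ j) g) x :> deriv ((deriv ^^ j) g) x" if "x \<in> S" for x
      using differentiable_on_DERIV[OF assms(1)] that by blast
    have "deriv f y = g y" if "y \<in> S" for y
      using assms(2)[OF that] by (rule DERIV_imp_deriv)
    then have "(deriv ^^ j) (deriv f) y = (deriv ^^ j) g y" if "y \<in> S" for y
      using higher_deriv_cong_on[OF assms(1) that] by blast
    then have "DERIV ((deriv ^^ k) f) x :> deriv ((deriv ^^ j) g) x" if "x \<in> S" for x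
      unfolding Suc higher_deriv_Suc
      by (rule DERIV_cong_on[OF assms(1) that]) (use that g in auto)
    then show ?thesis by (rule DERIV_differentiable_on)
  qed
qed

lemma smooth_on_DERIV:
  assumes "open S" "smooth_on S f" "x \<in> S"
  shows "DERIV f x :> deriv f x"
proof (rule differentiable_on_DERIV[OF assms(1) _ assms(3)])
  show "f differentiable_on S"
    using assms(2) unfolding smooth_on_def by (metis funpow_0)
qed

lemma smooth_on_deriv: "smooth_on S f \<Longrightarrow> smooth_on S (deriv f)"
  unfolding smooth_on_iff_upto by (metis smooth_upto_Suc)

lemma smooth_on_DERIVI:
  assumes "open S" "\<And>x. x \<in> S \<Longrightarrow> DERIV f x :> g x" "smooth_on S g"
  shows "smooth_on S f"
  unfolding smooth_on_iff_upto
proof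
  fix n
  have "smooth_upto (Suc n) S f"
    using assms(3) smooth_upto_Suc_DERIV[OF assms(1,2)] by (auto simp: smooth_on_iff_upto)
  then show "smooth_upto n S f" by (rule smooth_upto_mono) simp
qed

lemma smooth_on_const: "open S \<Longrightarrow> smooth_on S (\<lambda>x. c)"
  unfolding smooth_on_iff_upto
proof
  fix n assume S: "open S"
  show "smooth_upto n S (\<lambda>x. c)"
  proof (induction n arbitrary: c)
    case (Suc n)
    show ?case
      by (rule smooth_upto_Suc_DERIV[OF S DERIV_const Suc.IH])
  qed (simp add: smooth_upto_0)
qed

lemma smooth_upto_add:
  assumes S: "open S"
  shows "smooth_upto n S f \<Longrightarrow> smooth_upto n S g \<Longrightarrow> smooth_upto n S (\<lambda>x. f x + g x)"
proof (induction n arbitrary: f g)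
  case (Suc n)
  show ?case
  proof (rule smooth_upto_Suc_DERIV[OF S, where g = "\<lambda>x. deriv f x + deriv g x"])
    show "smooth_upto n S (\<lambda>x. deriv f x + deriv g x)"
      using Suc by (simp add: smooth_upto_Suc)
    fix x assume "x \<in> S"
    then show "DERIV (\<lambda>x. f x + g x) x :> deriv f x + deriv g x"
      using Suc.prems by (intro DERIV_add differentiable_on_DERIV[OF S]) (auto simp: smooth_upto_Suc)
  qed
qed (simp add: smooth_upto_0)

lemma smooth_on_add: "open S \<Longrightarrow> smooth_on S f \<Longrightarrow> smooth_on S g \<Longrightarrow> smooth_on S (\<lambda>x. f x + g x)"
  unfolding smooth_on_iff_upto using smooth_upto_add by blast

lemma smooth_upto_mult:
  assumes S: "open S"
  shows "smooth_upto n S f \<Longrightarrow> smooth_upto n S g \<Longrightarrow> smooth_upto n S (\<lambda>x. f x * g x)"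
proof (induction n arbitrary: f g)
  case (Suc n)
  show ?case
  proof (rule smooth_upto_Suc_DERIV[OF S, where g = "\<lambda>x. deriv f x * g x + deriv g x * f x"])
    have "smooth_upto n S f" "smooth_upto n S g"
      using Suc.prems smooth_upto_mono by (metis le_SucI order_refl)+
    then show "smooth_upto n S (\<lambda>x. deriv f x * g x + deriv g x * f x)"
      using Suc by (intro smooth_upto_add[OF S]) (auto simp: smooth_upto_Suc)
    fix x assume "x \<in> S"
    then show "DERIV (\<lambda>x. f x * g x) x :> deriv f x * g x + deriv g x * f x"
      using Suc.prems by (intro DERIV_mult differentiable_on_DERIV[OF S]) (auto simp: smooth_upto_Suc)
  qed
qed (simp add: smooth_upto_0)

lemma smooth_on_mult: "open S \<Longrightarrow> smooth_on S f \<Longrightarrow> smooth_on S g \<Longrightarrow> smooth_on S (\<lambda>x. f x * g x)"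
  unfolding smooth_on_iff_upto using smooth_upto_mult by blast

lemma smooth_on_powr: "smooth_on {0<..} (\<lambda>x. x powr a)"
  unfolding smooth_on_iff_upto
proof
  fix n
  show "smooth_upto n {0<..} (\<lambda>x. x powr a)"
  proof (induction n arbitrary: a)
    case (Suc n)
    show ?case
    proof (rule smooth_upto_Suc_DERIV[where g = "\<lambda>x. a * x powr (a - 1)"])
      show "smooth_upto n {0<..} (\<lambda>x. a * x powr (a - 1))"
        using smooth_on_const[of "{0<..}" a]
        by (intro smooth_upto_mult Suc.IH) (auto simp: smooth_on_iff_upto)
    qed (use has_real_derivative_powr in auto)
  qed (simp add: smooth_upto_0)
qed

lemma higher_deriv_exp: "(deriv ^^ k) (\<lambda>x. c * exp (s * x)) = (\<lambda>x. c * s ^ k * exp (s * x))"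
  for c s :: real
proof (induction k)
  case (Suc k)
  have "DERIV (\<lambda>x. c * s ^ k * exp (s * x)) x :> c * s ^ Suc k * exp (s * x)" for x
    by (auto intro!: derivative_eq_intros)
  then have "deriv (\<lambda>x. c * s ^ k * exp (s * x)) x = c * s ^ Suc k * exp (s * x)" for x
    by (rule DERIV_imp_deriv)
  then show ?case
    by (simp only: funpow.simps o_def Suc.IH)
qed simp

section \<open>Order of vanishing\<close>

definition vanishes :: "nat \<Rightarrow> real \<Rightarrow> (real \<Rightarrow> real) \<Rightarrow> bool" where
  "vanishes n a f \<longleftrightarrow> (\<forall>k<n. (deriv ^^ k) f a = 0)"

lemma vanishes_0: "vanishes 0 a f"
  by (simp add: vanishes_def)

lemma vanishes_Suc: "vanishes (Suc n) a f \<longleftrightarrow> f a = 0 \<and> vanishes n a (deriv f)"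
  unfolding vanishes_def All_less_Suc2 higher_deriv_Suc by simp

lemma vanishes_deriv: "vanishes n a f \<Longrightarrow> vanishes (n - 1) a (deriv f)"
  by (cases n) (auto simp: vanishes_Suc vanishes_0)

lemma vanishes_cong_on:
  assumes "open S" "a \<in> S" "\<And>y. y \<in> S \<Longrightarrow> f y = g y" "vanishes n a g"
  shows "vanishes n a f"
  using assms higher_deriv_cong_on[OF assms(1,2), of f g] by (auto simp: vanishes_def)

lemma vanishes_add:
  assumes S: "open S" "a \<in> S"
  shows "smooth_on S f \<Longrightarrow> smooth_on S g \<Longrightarrow> vanishes n a f \<Longrightarrow> vanishes n a g
    \<Longrightarrow> vanishes n a (\<lambda>x. f x + g x)"
proof (induction n arbitrary: f g)
  case (Suc n)
  have "deriv (\<lambda>x. f x + g x) y = deriv f y + deriv g y" if "y \<in> S" for y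
    using Suc.prems that by (intro DERIV_imp_deriv DERIV_add smooth_on_DERIV[OF S(1)])
  moreover have "vanishes n a (\<lambda>x. deriv f x + deriv g x)"
    using Suc by (simp add: vanishes_Suc smooth_on_deriv)
  ultimately have "vanishes n a (deriv (\<lambda>x. f x + g x))"
    by (rule vanishes_cong_on[OF S])
  then show ?case using Suc.prems by (simp add: vanishes_Suc)
qed (simp add: vanishes_0)

text \<open>Orders of zeros add. By the Leibniz rule each summand of the derivative lowers the order
  of only one factor, so the total drops by one, in step with \<open>l\<close>.\<close>

lemma vanishes_mult:
  assumes S: "open S" "a \<in> S"
  shows "smooth_on S f \<Longrightarrow> smooth_on S g \<Longrightarrow> vanishes n a f \<Longrightarrow> vanishes m a g
    \<Longrightarrow> l \<le> n + m \<Longrightarrow> vanishes l a (\<lambda>x. f x * g x)"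
proof (induction l arbitrary: f g n m)
  case (Suc l)
  have "deriv (\<lambda>x. f x * g x) y = deriv f y * g y + deriv g y * f y" if "y \<in> S" for y
    using Suc.prems that by (intro DERIV_imp_deriv DERIV_mult smooth_on_DERIV[OF S(1)])
  moreover have "vanishes l a (\<lambda>x. deriv f x * g x + deriv g x * f x)"
  proof (rule vanishes_add[OF S])
    \<comment> \<open>The subtraction is truncated: for \<open>n = 0\<close> nothing is lost, and
      \<open>l \<le> 0 + m\<close> still follows from \<open>Suc l \<le> m\<close>.\<close>
    show "vanishes l a (\<lambda>x. deriv f x * g x)"
      by (rule Suc.IH[of _ _ "n - 1" m]) (use Suc.prems in \<open>auto intro: smooth_on_deriv vanishes_deriv simp del: One_nat_def\<close>)
    show "vanishes l a (\<lambda>x. deriv g x * f x)"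
      by (rule Suc.IH[of _ _ "m - 1" n]) (use Suc.prems in \<open>auto intro: smooth_on_deriv vanishes_deriv simp del: One_nat_def\<close>)
  qed (use Suc.prems S in \<open>auto intro!: smooth_on_mult smooth_on_deriv\<close>)
  ultimately have "vanishes l a (deriv (\<lambda>x. f x * g x))"
    by (rule vanishes_cong_on[OF S])
  moreover have "f a * g a = 0"
    using Suc.prems by (cases n; cases m) (auto simp: vanishes_Suc)
  ultimately show ?case by (simp add: vanishes_Suc)
qed (simp add: vanishes_0)

text \<open>A Taylor estimate by iterated mean value inequalities: the bound for
  \<open>deriv f\<close>, taken on the segment from \<open>r\<close> to \<open>a\<close>, is largest
  at \<open>r\<close> and gains one factor \<open>\<bar>r - a\<bar>\<close>. The induction starts
  from compactness.\<close>

lemma vanishes_bound: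
  assumes S: "open S" "{c..d} \<subseteq> S" and a: "a \<in> {c..d}"
  shows "smooth_on S f \<Longrightarrow> vanishes n a f \<Longrightarrow> \<exists>C\<ge>0. \<forall>r\<in>{c..d}. \<bar>f r\<bar> \<le> C * \<bar>r - a\<bar> ^ n"
proof (induction n arbitrary: f)
  case 0
  have "continuous_on {c..d} f"
    using smooth_on_DERIV[OF S(1) 0(1)] S(2)
    by (intro continuous_at_imp_continuous_on ballI DERIV_isCont) blast
  then have "bounded (f ` {c..d})"
    by (intro compact_imp_bounded compact_continuous_image compact_Icc)
  then obtain C where "\<forall>r\<in>{c..d}. \<bar>f r\<bar> \<le> C"
    unfolding bounded_iff by auto
  then show ?case using a by (intro exI[of _ C]) force
next
  case (Suc n)
  have v: "f a = 0" "vanishes n a (deriv f)"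
    using Suc.prems by (auto simp: vanishes_Suc)
  obtain C where C: "C \<ge> 0" "\<And>r. r \<in> {c..d} \<Longrightarrow> \<bar>deriv f r\<bar> \<le> C * \<bar>r - a\<bar> ^ n"
    using Suc.IH[OF smooth_on_deriv[OF Suc.prems(1)] v(2)] by blast
  have "\<bar>f r\<bar> \<le> C * \<bar>r - a\<bar> ^ Suc n" if r: "r \<in> {c..d}" for r
  proof -
    have seg: "closed_segment r a \<subseteq> {c..d}"
      using r a by (simp add: closed_segment_eq_real_ivl)
    have "norm (f r - f a) \<le> C * \<bar>r - a\<bar> ^ n * norm (r - a)"
    proof (rule field_differentiable_bound[where S = "closed_segment r a" and f' = "deriv f"])
      fix z assume z: "z \<in> closed_segment r a"
      then have zS: "z \<in> {c..d}" "z \<in> S" using seg S by auto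
      show "(f has_real_derivative deriv f z) (at z within closed_segment r a)"
        using smooth_on_DERIV[OF S(1) Suc.prems(1) zS(2)] by (rule has_field_derivative_at_within)
      have "\<bar>z - a\<bar> \<le> \<bar>r - a\<bar>"
        using z by (auto simp: closed_segment_eq_real_ivl split: if_splits)
      then have "C * \<bar>z - a\<bar> ^ n \<le> C * \<bar>r - a\<bar> ^ n"
        using C(1) by (intro mult_left_mono power_mono) auto
      then show "norm (deriv f z) \<le> C * \<bar>r - a\<bar> ^ n"
        using C(2)[OF zS(1)] by simp
    qed auto
    then show ?thesis using v by (simp add: mult_ac)
  qed
  then show ?case using C(1) by blast
qed

section \<open>Scalar autonomous differential equations\<close>

text \<open>Along a solution of \<open>v' = P(v)\<close> the time derivative acts on functions of the state as
  the following vector field.\<close>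

definition lie :: "(real \<Rightarrow> real) \<Rightarrow> (real \<Rightarrow> real) \<Rightarrow> real \<Rightarrow> real" where
  "lie P h = (\<lambda>r. deriv h r * P r)"

lemma smooth_on_lie:
  "open S \<Longrightarrow> smooth_on S P \<Longrightarrow> smooth_on S h \<Longrightarrow> smooth_on S ((lie P ^^ k) h)"
  by (induction k) (auto simp: lie_def intro!: smooth_on_mult smooth_on_deriv)

text \<open>The derivative costs one order and the factor \<open>P\<close> returns
  \<open>Suc p\<close>, so each step gains \<open>p\<close>. The cases of interest are
  \<open>p = 0\<close> (simple zero) and \<open>p = 1\<close> (double zero).\<close>

lemma vanishes_lie:
  assumes "open S" "a \<in> S" "smooth_on S P" "smooth_on S h" "vanishes (Suc p) a P" "h a = 0"
  shows "vanishes (1 + k * p) a ((lie P ^^ k) h)"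
proof (induction k)
  case 0
  then show ?case using assms by (simp add: vanishes_def)
next
  case (Suc k)
  have sm: "smooth_on S ((lie P ^^ k) h)"
    using assms by (intro smooth_on_lie)
  have "vanishes (1 + Suc k * p) a (\<lambda>r. deriv ((lie P ^^ k) h) r * P r)"
    by (rule vanishes_mult[OF assms(1,2) smooth_on_deriv[OF sm] assms(3) vanishes_deriv[OF Suc] assms(5)])
      simp
  then show ?case by (simp add: lie_def[of P "(lie P ^^ k) h"])
qed

text \<open>Both \<open>h\<close> and \<open>\<phi>\<close> vary in the induction, since the chain
  rule turns the pair into \<open>lie P h\<close> and \<open>deriv \<phi>\<close>.\<close>

lemma higher_deriv_along_solution:
  assumes "open S" "open T" "smooth_on S P" "\<And>x. x \<in> T \<Longrightarrow> v x \<in> S"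
    and v: "\<And>x. x \<in> T \<Longrightarrow> DERIV v x :> P (v x)"
  shows "smooth_on S h \<Longrightarrow> (\<And>x. x \<in> T \<Longrightarrow> \<phi> x = h (v x)) \<Longrightarrow> x \<in> T
    \<Longrightarrow> (deriv ^^ k) \<phi> x = (lie P ^^ k) h (v x)"
proof (induction k arbitrary: h \<phi>)
  case (Suc k)
  have "deriv \<phi> y = lie P h (v y)" if "y \<in> T" for y
  proof -
    have d: "DERIV (\<lambda>y. h (v y)) y :> deriv h (v y) * P (v y)"
      using assms Suc.prems(1) that by (intro DERIV_chain2 smooth_on_DERIV[OF assms(1)]) auto
    have "DERIV \<phi> y :> deriv h (v y) * P (v y)"
      by (rule DERIV_cong_on[OF assms(2) that _ d]) (rule Suc.prems(2))
    then show ?thesis by (simp add: DERIV_imp_deriv lie_def)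
  qed
  moreover have "smooth_on S (lie P h)"
    using smooth_on_lie[OF assms(1,3) Suc.prems(1), of 1] by simp
  ultimately have "(deriv ^^ k) (deriv \<phi>) x = (lie P ^^ k) (lie P h) (v x)"
    using Suc.prems(3) by (intro Suc.IH) auto
  then show ?case
    unfolding higher_deriv_Suc by (simp add: funpow_swap1)
qed simp

lemma smooth_on_along_solution:
  assumes "open S" "open T" "smooth_on S P" "\<And>x. x \<in> T \<Longrightarrow> v x \<in> S"
    and "\<And>x. x \<in> T \<Longrightarrow> DERIV v x :> P (v x)"
    and "smooth_on S h" "\<And>x. x \<in> T \<Longrightarrow> \<phi> x = h (v x)"
  shows "smooth_on T \<phi>"
  unfolding smooth_on_def
proof (intro allI DERIV_differentiable_on)
  fix k x assume x: "x \<in> T"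
  have "smooth_on S ((lie P ^^ k) h)"
    using assms by (intro smooth_on_lie)
  then have d: "DERIV (\<lambda>x. (lie P ^^ k) h (v x)) x :> deriv ((lie P ^^ k) h) (v x) * P (v x)"
    using assms x by (intro DERIV_chain2 smooth_on_DERIV[OF assms(1)]) auto
  show "DERIV ((deriv ^^ k) \<phi>) x :> deriv ((lie P ^^ k) h) (v x) * P (v x)"
    by (rule DERIV_cong_on[OF assms(2) x _ d]) (rule higher_deriv_along_solution[OF assms])
qed

text \<open>The limit controls a tail and compactness the remaining initial interval. The bound
  \<open>c > 0\<close> keeps orbits away from the singularity of the field at 0.\<close>

lemma eventually_const_bounded:
  fixes v :: "real \<Rightarrow> real"
  assumes cont: "continuous_on {0..} v" and lim: "(v \<longlongrightarrow> l) at_top" and l: "0 < l"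
    and pos: "\<And>x. 0 \<le> x \<Longrightarrow> 0 < v x"
  shows "\<exists>c>0. \<exists>d. \<forall>x\<ge>0. v x \<in> {c..d}"
proof -
  have "\<forall>\<^sub>F x in at_top. v x > l / 2" "\<forall>\<^sub>F x in at_top. v x < 2 * l"
    using l order_tendstoD(1)[OF lim, of "l / 2"] order_tendstoD(2)[OF lim, of "2 * l"] by auto
  then have "\<forall>\<^sub>F x in at_top. l / 2 < v x \<and> v x < 2 * l"
    by eventually_elim simp
  then obtain N where N: "\<And>x. x \<ge> N \<Longrightarrow> l / 2 < v x \<and> v x < 2 * l"
    unfolding eventually_at_top_linorder by blast
  define M where "M = max N 0"
  have cM: "continuous_on {0..M} v"
    using cont by (rule continuous_on_subset) auto
  have ne: "{0..M} \<noteq> {}" by (simp add: M_def)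
  obtain s where s: "s \<in> {0..M}" "\<And>x. x \<in> {0..M} \<Longrightarrow> v s \<le> v x"
    using continuous_attains_inf[OF compact_Icc ne cM] by blast
  obtain t where t: "\<And>x. x \<in> {0..M} \<Longrightarrow> v x \<le> v t"
    using continuous_attains_sup[OF compact_Icc ne cM] by blast
  have "v x \<in> {min (l / 2) (v s)..max (2 * l) (v t)}" if "x \<ge> 0" for x
  proof (cases "x \<le> M")
    case True
    then show ?thesis using s t that by (auto simp: min_le_iff_disj le_max_iff_disj)
  next
    case False
    then have "x \<ge> N" by (simp add: M_def)
    then show ?thesis using N[of x] by (auto simp: min_le_iff_disj le_max_iff_disj)
  qed
  moreover have "min (l / 2) (v s) > 0" using l s pos by auto
  ultimately show ?thesis by blast
qed

lemma smooth_on_lipschitz: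
  assumes "open S" "{c..d} \<subseteq> S" "smooth_on S P"
  shows "\<exists>L\<ge>0. \<forall>r\<in>{c..d}. \<forall>s\<in>{c..d}. \<bar>P r - P s\<bar> \<le> L * \<bar>r - s\<bar>"
proof (cases "c \<le> d")
  case True
  \<comment> \<open>Vanishing of order 0 is no condition, so \<open>vanishes_bound\<close> here just
    bounds \<open>deriv P\<close> on the compact interval.\<close>
  then obtain L where L: "L \<ge> 0" "\<And>r. r \<in> {c..d} \<Longrightarrow> \<bar>deriv P r\<bar> \<le> L"
    using vanishes_bound[OF assms(1,2) _ smooth_on_deriv[OF assms(3)] vanishes_0, of c] by auto
  have "norm (P r - P s) \<le> L * norm (r - s)" if rs: "r \<in> {c..d}" "s \<in> {c..d}" for r s
  proof (rule field_differentiable_bound[where S = "{c..d}" and f' = "deriv P"])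
    fix z assume "z \<in> {c..d}"
    then show "(P has_real_derivative deriv P z) (at z within {c..d})"
      using assms by (intro has_field_derivative_at_within[OF smooth_on_DERIV]) auto
  qed (use rs L in auto)
  then show ?thesis using L(1) by auto
qed auto

text \<open>Gronwall's argument for the squared difference, run forwards and backwards from
  \<open>t\<close>. The backward direction is what later excludes arrival at an equilibrium in
  finite time.\<close>

lemma autonomous_unique:
  assumes S: "open S" "{c..d} \<subseteq> S" "smooth_on S P"
    and cont: "continuous_on {0..} v" "continuous_on {0..} w"
    and ran: "\<And>x. 0 \<le> x \<Longrightarrow> v x \<in> {c..d}" "\<And>x. 0 \<le> x \<Longrightarrow> w x \<in> {c..d}"
    and der: "\<And>x. 0 < x \<Longrightarrow> DERIV v x :> P (v x)" "\<And>x. 0 < x \<Longrightarrow> DERIV w x :> P (w x)"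
    and t: "0 \<le> t" "v t = w t" and x: "0 \<le> x"
  shows "v x = w x"
proof -
  obtain L where L: "\<And>r s. r \<in> {c..d} \<Longrightarrow> s \<in> {c..d} \<Longrightarrow> \<bar>P r - P s\<bar> \<le> L * \<bar>r - s\<bar>"
    using smooth_on_lipschitz[OF S] by blast
  define D where "D x = (v x - w x)\<^sup>2" for x
  define D' where "D' x = 2 * (v x - w x) * (P (v x) - P (w x))" for x
  have D: "DERIV D x :> D' x" if "x > 0" for x
    unfolding D_def[abs_def] D'_def
    by (rule derivative_eq_intros der[OF that] refl | simp)+
  have bound: "\<bar>D' x\<bar> \<le> 2 * L * D x" if "x > 0" for x
  proof -
    have "\<bar>D' x\<bar> = 2 * \<bar>v x - w x\<bar> * \<bar>P (v x) - P (w x)\<bar>"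
      unfolding D'_def abs_mult by simp
    also have "\<dots> \<le> 2 * \<bar>v x - w x\<bar> * (L * \<bar>v x - w x\<bar>)"
      using L ran that by (intro mult_left_mono) auto
    also have "\<dots> = 2 * L * \<bar>v x - w x\<bar>\<^sup>2" by (simp add: power2_eq_square)
    finally show ?thesis by (simp add: D_def)
  qed
  have contD: "continuous_on {a..b} (\<lambda>x. D x * exp (k * x))" if "0 \<le> a" for a b k
    unfolding D_def using that
    by (intro continuous_intros continuous_on_subset[OF cont(1)] continuous_on_subset[OF cont(2)]) auto
  have der': "DERIV (\<lambda>x. D x * exp (k * x)) x :> (D' x + k * D x) * exp (k * x)" if "x > 0" for k x
    by (rule derivative_eq_intros D[OF that] refl | simp add: algebra_simps)+
  have "D x = 0"
  proof (cases "x \<le> t")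
    case True
    \<comment> \<open>The weight absorbs the bound on \<open>D'\<close>, so the product is
      nondecreasing and its zero at \<open>t\<close> propagates to earlier times. The other case
      uses the reciprocal weight.\<close>
    have "D x * exp (2 * L * x) \<le> D t * exp (2 * L * t)"
    proof (rule DERIV_nonneg_imp_increasing_open[OF True _ contD[OF x]])
      fix y assume "x < y" "y < t"
      then have "y > 0" using x by simp
      then show "\<exists>z. DERIV (\<lambda>x. D x * exp (2 * L * x)) y :> z \<and> 0 \<le> z"
        using der'[of y "2 * L"] bound[of y] by (intro exI conjI) (auto intro!: mult_nonneg_nonneg)
    qed
    then have "D x \<le> 0" using t by (simp add: D_def mult_le_0_iff)
    then show ?thesis by (simp add: D_def)
  next
    case False
    then have "t \<le> x" by simp
    then have "D t * exp (- 2 * L * t) \<ge> D x * exp (- 2 * L * x)"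
    proof (rule DERIV_nonpos_imp_decreasing_open[OF _ _ contD[OF t(1)]])
      fix y assume "t < y" "y < x"
      then have "y > 0" using t by simp
      then show "\<exists>z. DERIV (\<lambda>x. D x * exp (- 2 * L * x)) y :> z \<and> z \<le> 0"
        using der'[of y "- 2 * L"] bound[of y] by (intro exI conjI) (auto intro!: mult_nonpos_nonneg)
    qed
    then have "D x \<le> 0" using t by (simp add: D_def mult_le_0_iff)
    then show ?thesis by (simp add: D_def)
  qed
  then show ?thesis by (simp add: D_def)
qed

text \<open>The solution is the inverse of an antiderivative of \<open>1 / q\<close>.\<close>

lemma autonomous_global_exists:
  fixes q :: "real \<Rightarrow> real"
  assumes cont: "\<And>x. isCont q x" and pos: "\<And>x. 0 < q x" and le: "\<And>x. q x \<le> L"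
  shows "\<exists>S. S 0 = 0 \<and> (\<forall>x. DERIV S x :> q (S x)) \<and> filterlim S at_top at_top"
proof -
  have L: "L > 0" using pos le by (rule less_le_trans)
  have "\<exists>T. \<forall>x::real. -\<infinity> < ereal x \<longrightarrow> ereal x < \<infinity> \<longrightarrow> (T has_vector_derivative 1 / q x) (at x)"
    by (rule einterval_antiderivative) (use cont pos in \<open>auto intro!: continuous_intros simp: less_imp_neq[THEN not_sym]\<close>)
  then obtain T0 where "\<And>x. DERIV T0 x :> 1 / q x"
    by (auto simp: has_real_derivative_iff_has_vector_derivative)
  moreover define T where "T x = T0 x - T0 0" for x
  ultimately have T: "DERIV T x :> 1 / q x" for x
    unfolding T_def[abs_def] by (auto intro!: derivative_eq_intros)
  have T0: "T 0 = 0" by (simp add: T_def)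
  \<comment> \<open>The upper bound on \<open>q\<close> gives \<open>T\<close> slope at least
    \<open>1 / L\<close>; hence \<open>T\<close> is onto, and its inverse is defined for all
    times.\<close>
  have incr: "(t - s) / L \<le> T t - T s" if "s \<le> t" for s t
  proof (cases "s = t")
    case False
    then have "\<exists>z. s < z \<and> z < t \<and> T t - T s = (t - s) * (1 / q z)"
      using that T by (intro MVT2) auto
    then obtain z where z: "T t - T s = (t - s) * (1 / q z)" by blast
    have "1 / L \<le> 1 / q z" using le[of z] pos[of z] by (simp add: frac_le)
    then show ?thesis using z that mult_left_mono[of "1 / L" "1 / q z" "t - s"] by simp
  qed simp
  have strict: "T s < T t" if "s < t" for s t
    using incr[of s t] that L by (smt (verit) divide_pos_pos)
  have contT: "isCont T x" for x by (rule DERIV_isCont[OF T])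
  have ex: "\<exists>s. T s = x" for x
  proof -
    have "T (- (L * \<bar>x\<bar>)) \<le> x"
      using incr[of "- (L * \<bar>x\<bar>)" 0] L T0 by simp
    moreover have "x \<le> T (L * \<bar>x\<bar>)"
      using incr[of 0 "L * \<bar>x\<bar>"] L T0 by simp
    moreover have "- (L * \<bar>x\<bar>) \<le> L * \<bar>x\<bar>" using L by simp
    ultimately show ?thesis using contT IVT[of T "- (L * \<bar>x\<bar>)" x "L * \<bar>x\<bar>"] by blast
  qed
  define S where "S x = (SOME s. T s = x)" for x
  have TS: "T (S x) = x" for x unfolding S_def using someI_ex[OF ex] .
  have ST: "S (T s) = s" for s
    using strict[of s "S (T s)"] strict[of "S (T s)" s] TS[of "T s"] by (cases "S (T s)" s rule: linorder_cases) auto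
  have contS: "isCont S x" for x
    using isCont_inverse_function[of 1 "S x" S T] ST TS contT by simp
  have "DERIV S x :> inverse (1 / q (S x))" for x
    by (rule DERIV_inverse_function[where f = T and a = "x - 1" and b = "x + 1"])
      (use T pos[of "S x"] TS contS in auto)
  moreover have "filterlim S at_top at_top"
    unfolding filterlim_at_top
  proof
    fix M
    have "M \<le> S x" if "x \<ge> T M" for x
      using strict[of "S x" M] that TS[of x] by linarith
    then show "\<forall>\<^sub>F x in at_top. M \<le> S x"
      using eventually_at_top_linorder by blast
  qed
  moreover have "S 0 = 0" using ST[of 0] T0 by simp
  ultimately show ?thesis by auto
qed

text \<open>In the variable \<open>- ln y\<close> the field becomes bounded, so the solution exists globally and never
  reaches the equilibrium \<open>0\<close>.\<close>

lemma decaying_solution_exists: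
  fixes g :: "real \<Rightarrow> real"
  assumes y0: "y0 > 0" and cont: "continuous_on {0<..y0} g"
    and g: "\<And>y. 0 < y \<Longrightarrow> y \<le> y0 \<Longrightarrow> 0 < g y \<and> g y \<le> L * y"
  shows "\<exists>y. y 0 = y0 \<and> continuous_on {0..} y \<and> (\<forall>x\<ge>0. 0 < y x \<and> y x \<le> y0) \<and>
    (\<forall>x>0. DERIV y x :> - g (y x)) \<and> (y \<longlongrightarrow> 0) at_top"
proof -
  \<comment> \<open>The substitution \<open>y = y0 * exp (- s)\<close> turns
    \<open>y' = - g y\<close> into \<open>s' = g y / y\<close>. The truncation at 0 keeps
    \<open>e s\<close> in the interval \<open>{0<..y0}\<close> where \<open>g\<close> is controlled;
    it is inactive along the solution, which satisfies \<open>S x \<ge> 0\<close> for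
    \<open>x \<ge> 0\<close>.\<close>
  define e where "e s = y0 * exp (- max s 0)" for s :: real
  have e: "0 < e s" "e s \<le> y0" for s
    using y0 by (auto simp: e_def)
  define q where "q s = g (e s) / e s" for s
  have "continuous_on UNIV e"
    unfolding e_def by (intro continuous_intros)
  moreover have "continuous_on UNIV (\<lambda>s. g (e s))"
    by (rule continuous_on_compose2[OF cont \<open>continuous_on UNIV e\<close>]) (use e in auto)
  ultimately have "continuous_on UNIV q"
    unfolding q_def using e by (intro continuous_intros) (auto simp: less_imp_neq[THEN not_sym])
  then have contq: "isCont q x" for x
    by (simp add: continuous_on_eq_continuous_at)
  have q: "0 < q s" "q s \<le> L" for s
    using g[OF e] e[of s] by (auto simp: q_def divide_simps)
  obtain S where S: "S 0 = 0" "\<And>x. DERIV S x :> q (S x)" "filterlim S at_top at_top"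
    using autonomous_global_exists[OF contq q] by blast
  have Spos: "S x \<ge> 0" if "x \<ge> 0" for x
  proof -
    have "S 0 \<le> S x"
      by (rule DERIV_nonneg_imp_nondecreasing[OF that]) (use S(2) q(1) less_imp_le in blast)
    then show ?thesis using S(1) by simp
  qed
  have eS: "e (S x) = y0 * exp (- S x)" if "x \<ge> 0" for x
    using Spos[OF that] by (simp add: e_def)
  define y where "y x = y0 * exp (- S x)" for x
  have der: "DERIV y x :> - g (y x)" if "x > 0" for x
  proof -
    have "DERIV y x :> y0 * (exp (- S x) * - q (S x))"
      unfolding y_def[abs_def] by (rule derivative_eq_intros S refl | simp)+
    moreover have "q (S x) = g (y x) / y x"
      using eS[of x] that by (simp add: q_def y_def)
    ultimately show ?thesis using y0 by (simp add: y_def)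
  qed
  have "continuous_on {0..} y"
    unfolding y_def
    by (intro continuous_intros continuous_at_imp_continuous_on ballI DERIV_isCont[OF S(2)])
  moreover have "(y \<longlongrightarrow> y0 * 0) at_top"
    unfolding y_def
    by (intro tendsto_intros filterlim_compose[OF exp_at_bot]
        filterlim_compose[OF filterlim_uminus_at_bot_at_top] S(3))
  moreover have "0 < y x \<and> y x \<le> y0" if "x \<ge> 0" for x
    using e[of "S x"] eS[OF that] by (simp add: y_def)
  ultimately show ?thesis using der S(1) by (intro exI[of _ y]) (auto simp: y_def)
qed

section \<open>The reduced equation for the velocity\<close>

text \<open>For \<open>v = u / u\<^sub>+\<close> mass conservation gives \<open>\<rho> = \<rho>\<^sub>+ / v\<close>, and the momentum equation integrates
  to \<open>\<lambda> u\<^sub>+ v' = F(v)\<close>.\<close>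

locale viscous_flow =
  fixes K \<gamma> lam \<rho>p up :: real
  assumes gamma: "\<gamma> \<ge> 1" and K: "K > 0" and lam: "lam > 0" and rhop: "\<rho>p > 0" and up: "up < 0"
begin

abbreviation f :: "real \<Rightarrow> real" where
  "f \<equiv> F K \<gamma> \<rho>p up"

definition df :: "real \<Rightarrow> real" where
  "df r = \<rho>p * up\<^sup>2 - \<gamma> * K * \<rho>p powr \<gamma> * r powr (- \<gamma> - 1)"

definition P :: "real \<Rightarrow> real" where
  "P r = f r / (lam * up)"

text \<open>Positivity keeps the state in the domain on which \<open>P\<close> is smooth. The
  equation holds for \<open>x > 0\<close> only, and the boundary value is attached by
  continuity.\<close>

definition profile :: "real \<Rightarrow> (real \<Rightarrow> real) \<Rightarrow> bool" where
  "profile v0 v \<longleftrightarrow> continuous_on {0..} v \<and> v 0 = v0 \<and> (\<forall>x\<ge>0. 0 < v x) \<and>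
     (\<forall>x>0. DERIV v x :> P (v x)) \<and> (v \<longlongrightarrow> 1) at_top"

section \<open>Convexity of \<open>F\<close> and its signs between the zeros\<close>

lemma lam_up: "lam * up < 0"
  using lam up by (simp add: mult_pos_neg)

lemma f_1: "f 1 = 0"
  by (simp add: F_def)

lemma DERIV_f: "r > 0 \<Longrightarrow> DERIV f r :> df r"
  unfolding df_def by (rule F_has_derivative)

lemma A_pos: "0 < \<gamma> * K * \<rho>p powr \<gamma>"
  using gamma K rhop by simp

lemma df_strict_mono: "0 < r \<Longrightarrow> r < s \<Longrightarrow> df r < df s"
proof -
  assume "0 < r" "r < s"
  then have "s powr (- \<gamma> - 1) < r powr (- \<gamma> - 1)"
    using gamma by (intro powr_less_mono2_neg) auto
  then show ?thesis
    using A_pos unfolding df_def by (smt (verit) mult_strict_left_mono)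
qed

lemma df_mono: "0 < r \<Longrightarrow> r \<le> s \<Longrightarrow> df r \<le> df s"
  using df_strict_mono[of r s] by (cases "r = s") auto

lemma isCont_df: "0 < r \<Longrightarrow> isCont df r"
  unfolding df_def[abs_def] by (intro continuous_intros) auto

text \<open>Together with the monotonicity of \<open>df\<close> this carries all convexity arguments
  below: chords further to the right have larger slope.\<close>

lemma f_secant:
  assumes "0 < r" "0 < s" "r \<noteq> s"
  shows "\<exists>z. min r s < z \<and> z < max r s \<and> f r - f s = (r - s) * df z"
proof -
  have *: "\<exists>z. a < z \<and> z < b \<and> f b - f a = (b - a) * df z" if "0 < a" "a < b" for a b
    using that by (intro MVT2 DERIV_f) auto
  show ?thesis
  proof (cases "r < s")
    case True
    then show ?thesis using *[OF assms(1) True] by (auto simp: min_def max_def algebra_simps)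
  next
    case False
    then show ?thesis using *[OF assms(2)] assms by (auto simp: min_def max_def algebra_simps)
  qed
qed

lemma smooth_on_f: "smooth_on {0<..} f"
proof -
  have "DERIV f r :> \<rho>p * up\<^sup>2 + - (\<gamma> * K * \<rho>p powr \<gamma>) * r powr (- \<gamma> - 1)" if "r \<in> {0<..}" for r
    using DERIV_f[of r] that by (simp add: df_def)
  moreover have "smooth_on {0<..} (\<lambda>r. \<rho>p * up\<^sup>2 + - (\<gamma> * K * \<rho>p powr \<gamma>) * r powr (- \<gamma> - 1))"
    by (intro smooth_on_add smooth_on_mult smooth_on_const smooth_on_powr open_greaterThan)
  ultimately show ?thesis
    by (rule smooth_on_DERIVI[OF open_greaterThan])
qed

lemma smooth_on_P: "smooth_on {0<..} P"
  unfolding P_def[abs_def] divide_inverse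
  by (intro smooth_on_mult smooth_on_const smooth_on_f open_greaterThan)

lemma deriv_P: "0 < r \<Longrightarrow> deriv P r = df r / (lam * up)"
  unfolding P_def[abs_def] by (intro DERIV_imp_deriv DERIV_cdivide DERIV_f)

lemma vanishes_P: "vanishes 1 1 P"
  by (simp add: vanishes_def P_def f_1)

lemma vanishes_P_sonic: "df 1 = 0 \<Longrightarrow> vanishes 2 1 P"
  by (simp add: vanishes_def P_def f_1 numeral_2_eq_2 less_Suc_eq all_conj_distrib deriv_P flip: P_def[abs_def])

text \<open>The slope at the equilibrium compares the flow speed with the sound speed, so its sign
  translates every condition on the Mach number.\<close>

lemma df_1: "df 1 = \<rho>p * (up\<^sup>2 - (sound_speed K \<gamma> \<rho>p)\<^sup>2)"
proof -
  have "(sound_speed K \<gamma> \<rho>p)\<^sup>2 = K * \<gamma> * \<rho>p powr (\<gamma> - 1)"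
    using gamma K by (simp add: sound_speed_eq[OF rhop])
  then show ?thesis
    using rhop by (simp add: df_def powr_diff algebra_simps)
qed

lemma sound_speed_pos: "0 < sound_speed K \<gamma> \<rho>p"
  using gamma K rhop by (simp add: sound_speed_eq[OF rhop])

lemma mach_gt_1_iff: "mach K \<gamma> \<rho>p up > 1 \<longleftrightarrow> df 1 > 0"
proof -
  have "mach K \<gamma> \<rho>p up > 1 \<longleftrightarrow> sound_speed K \<gamma> \<rho>p < \<bar>up\<bar>"
    using sound_speed_pos by (simp add: mach_def less_divide_eq)
  also have "\<dots> \<longleftrightarrow> (sound_speed K \<gamma> \<rho>p)\<^sup>2 < up\<^sup>2"
    using sound_speed_pos abs_le_square_iff[of up "sound_speed K \<gamma> \<rho>p"] by auto
  finally show ?thesis using rhop by (simp add: df_1 zero_less_mult_iff)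
qed

lemma mach_lt_1_iff: "mach K \<gamma> \<rho>p up < 1 \<longleftrightarrow> df 1 < 0"
proof -
  have "mach K \<gamma> \<rho>p up < 1 \<longleftrightarrow> \<bar>up\<bar> < sound_speed K \<gamma> \<rho>p"
    using sound_speed_pos by (simp add: mach_def divide_less_eq)
  also have "\<dots> \<longleftrightarrow> up\<^sup>2 < (sound_speed K \<gamma> \<rho>p)\<^sup>2"
    using sound_speed_pos abs_le_square_iff[of "sound_speed K \<gamma> \<rho>p" up] by auto
  finally show ?thesis using rhop by (simp add: df_1 mult_less_0_iff)
qed

lemma mach_ge_1_iff: "mach K \<gamma> \<rho>p up \<ge> 1 \<longleftrightarrow> df 1 \<ge> 0"
  using mach_lt_1_iff by linarith

lemma mach_eq_1_iff: "mach K \<gamma> \<rho>p up = 1 \<longleftrightarrow> df 1 = 0"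
  using mach_lt_1_iff mach_gt_1_iff by linarith

lemma f_pos_above_1:
  assumes "df 1 \<ge> 0" "r > 1"
  shows "f r > 0"
proof -
  obtain z where z: "1 < z" "f r - f 1 = (r - 1) * df z"
    using f_secant[of r 1] assms by auto
  have "0 < df z" using df_strict_mono[of 1 z] z assms by linarith
  then show ?thesis using z assms by (simp add: f_1)
qed

lemma f_pos_below_1:
  assumes "df 1 \<le> 0" "0 < r" "r < 1"
  shows "f r > 0"
proof -
  obtain z where z: "r < z" "z < 1" "f r - f 1 = (r - 1) * df z"
    using f_secant[of r 1] assms by auto
  have "df z < 0" using df_strict_mono[of z 1] z assms by linarith
  then show ?thesis using z assms by (simp add: f_1 mult_neg_neg)
qed

text \<open>The pressure term is nonpositive for \<open>r \<ge> 1\<close> and nonnegative for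
  \<open>r \<le> 1\<close>, so dropping it leaves a linear bound on either side. This supplies the
  constant \<open>L\<close> for \<open>decaying_solution_exists\<close>.\<close>

lemma f_le: "r \<ge> 1 \<Longrightarrow> f r \<le> \<rho>p * up\<^sup>2 * (r - 1)"
  using gamma K powr_mono[of "- \<gamma>" 0 r] by (simp add: F_def mult_le_0_iff)

lemma f_ge: "0 < r \<Longrightarrow> r \<le> 1 \<Longrightarrow> \<rho>p * up\<^sup>2 * (r - 1) \<le> f r"
  using gamma K powr_mono'[of "- \<gamma>" 0 r] by (simp add: F_def)

lemma chi_c_supersonic:
  assumes "df 1 > 0"
  defines "c \<equiv> chi_c K \<gamma> \<rho>p up"
  shows "0 < c" "c < 1" "f c = 0" "\<And>r. c < r \<Longrightarrow> r < 1 \<Longrightarrow> f r < 0"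
proof -
  note roots = chi_c_roots[OF gamma K rhop mach_gt_1_iff[THEN iffD2, OF assms(1)], folded c_def]
  show pos: "0 < c" and root: "f c = 0"
    using roots(2) by auto
  show less: "c < 1"
  proof (rule ccontr)
    assume "\<not> c < 1"
    then have "f c > 0" using roots(1) assms by (intro f_pos_above_1) auto
    then show False using root by simp
  qed
  show "f r < 0" if r: "c < r" "r < 1" for r
  proof -
    \<comment> \<open>If \<open>f r \<ge> 0\<close>, the chord from \<open>c\<close> to
      \<open>r\<close> would rise and the one from \<open>r\<close> to 1 would not, against the
      strict growth of \<open>df\<close>.\<close>
    obtain y where y: "c < y" "y < r" "f r - f c = (r - c) * df y"
      using f_secant[of r c] r pos by auto
    obtain z where z: "r < z" "z < 1" "f r - f 1 = (r - 1) * df z"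
      using f_secant[of r 1] r pos by auto
    have lt: "df y < df z" using df_strict_mono[of y z] y z pos by auto
    show ?thesis
    proof (rule ccontr)
      assume "\<not> f r < 0"
      then have "0 \<le> (r - c) * df y" "0 \<le> (r - 1) * df z"
        using y z by (auto simp: root f_1)
      then have "0 \<le> df y" "df z \<le> 0"
        using r by (auto simp: zero_le_mult_iff)
      then show False using lt by simp
    qed
  qed
qed

lemma chi_c_not_supersonic: "df 1 \<le> 0 \<Longrightarrow> chi_c K \<gamma> \<rho>p up = 1"
  using mach_gt_1_iff by (simp add: chi_c_def)

section \<open>Profiles: uniqueness and the necessary conditions\<close>

lemma profileD:
  assumes "profile v0 v"
  shows "continuous_on {0..} v" "v 0 = v0" "\<And>x. 0 \<le> x \<Longrightarrow> 0 < v x"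
    "\<And>x. 0 < x \<Longrightarrow> DERIV v x :> P (v x)" "(v \<longlongrightarrow> 1) at_top"
  using assms by (auto simp: profile_def)

lemma profile_bounded:
  assumes "profile v0 v"
  obtains c d where "0 < c" "\<And>x. 0 \<le> x \<Longrightarrow> v x \<in> {c..d}"
  using eventually_const_bounded[OF profileD(1,5)[OF assms] zero_less_one profileD(3)[OF assms]] that
  by blast

lemma profile_continuous_on: "profile v0 v \<Longrightarrow> 0 \<le> a \<Longrightarrow> continuous_on {a..b} v"
  by (rule continuous_on_subset[OF profileD(1)]) auto

lemma profile_unique:
  assumes v: "profile v0 v" and w: "profile v0 w" and "0 \<le> x"
  shows "v x = w x"
proof -
  obtain a b where ab: "0 < a" "\<And>x. 0 \<le> x \<Longrightarrow> v x \<in> {a..b}" using profile_bounded[OF v] by blast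
  obtain c d where cd: "0 < c" "\<And>x. 0 \<le> x \<Longrightarrow> w x \<in> {c..d}" using profile_bounded[OF w] by blast
  show ?thesis
  proof (rule autonomous_unique[where S = "{0<..}" and c = "min a c" and d = "max b d" and t = 0 and v = v and w = w and x = x])
    show "v x \<in> {min a c..max b d}" "w x \<in> {min a c..max b d}" if "0 \<le> x" for x
      using ab(2)[OF that] cd(2)[OF that] by auto
  qed (use profileD[OF v] profileD[OF w] ab cd assms smooth_on_P in auto)
qed

text \<open>Comparison with the constant solution \<open>r\<close>: an orbit that meets an
  equilibrium at some time has been there from the start.\<close>

lemma profile_equilibrium:
  assumes v: "profile v0 v" and r: "0 < r" "f r = 0" and t: "0 \<le> t" "v t = r" and "0 \<le> x"
  shows "v x = r"
proof -
  obtain a b where ab: "0 < a" "\<And>x. 0 \<le> x \<Longrightarrow> v x \<in> {a..b}" using profile_bounded[OF v] by blast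
  show ?thesis
  proof (rule autonomous_unique[where S = "{0<..}" and c = a and d = b and t = t and v = v and x = x and w = "\<lambda>x. r"])
    show "((\<lambda>x. r) has_real_derivative P r) (at x)" for x
      using r by (simp add: P_def)
    show "r \<in> {a..b}" using ab(2)[OF t(1)] t by simp
  qed (use profileD[OF v] ab assms smooth_on_P in auto)
qed

lemma profile_constant_imp_1:
  assumes "profile v0 v" "\<And>x. 0 \<le> x \<Longrightarrow> v x = r"
  shows "r = 1"
proof (rule tendsto_unique[of at_top v])
  have "\<forall>\<^sub>F x in at_top. v x = r"
    using eventually_ge_at_top[of "0::real"] by eventually_elim (rule assms(2))
  then show "(v \<longlongrightarrow> r) at_top" by (rule tendsto_eventually)
qed (use profileD(5)[OF assms(1)] in auto)

lemma profile_sonic_decreasing: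
  assumes v: "profile v0 v" and "df 1 = 0" "0 \<le> x" "x \<le> y"
  shows "v y \<le> v x"
proof (rule DERIV_nonpos_imp_decreasing_open[OF assms(4) _ profile_continuous_on[OF v assms(3)]])
  fix z assume "x < z" "z < y"
  then have z: "0 < z" using assms by simp
  have "f (v z) \<ge> 0"
    using f_pos_above_1[of "v z"] f_pos_below_1[of "v z"] profileD(3)[OF v, of z] z assms f_1
    by (cases "v z" "1::real" rule: linorder_cases) auto
  then have "P (v z) \<le> 0"
    using lam_up by (simp add: P_def divide_le_0_iff)
  then show "\<exists>d. DERIV v z :> d \<and> d \<le> 0"
    using profileD(4)[OF v z] by blast
qed

lemma profile_sonic_ge_1:
  assumes v: "profile v0 v" and "df 1 = 0" "0 \<le> x"
  shows "1 \<le> v x"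
proof (rule tendsto_upperbound[OF profileD(5)[OF v]])
  show "\<forall>\<^sub>F y in at_top. v y \<le> v x"
    using eventually_ge_at_top[of x]
    by eventually_elim (rule profile_sonic_decreasing[OF assms])
qed simp

text \<open>Here 1 repels on both sides: once \<open>v\<close> is close to 1, the squared distance
  cannot decrease, yet it tends to 0. So \<open>v\<close> equals 1 at a finite time and hence at
  time 0.\<close>

lemma profile_subsonic:
  assumes v: "profile v0 v" and sub: "df 1 < 0"
  shows "v0 = 1"
proof -
  have "\<forall>\<^sub>F r in at 1. df r < 0"
    using isCont_df[of 1] sub by (auto simp: isCont_def intro: order_tendstoD)
  then have "\<forall>\<^sub>F r in at_right 1. df r < 0"
    by (simp add: eventually_at_split)
  then obtain s where s: "s > 1" "df s < 0"
    using eventually_happens[OF eventually_conj[OF _ eventually_at_right_less]] by force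
  \<comment> \<open>The mean value point lies below \<open>s\<close>, and \<open>df\<close>
    increases, so one negative slope to the right of 1 covers all states in
    \<open>{0<..s}\<close>.\<close>
  have f_neg: "(r - 1) * f r \<le> 0" if r: "0 < r" "r \<le> s" for r
  proof (cases "r = 1")
    case False
    then obtain z where z: "min r 1 < z" "z < max r 1" "f r - f 1 = (r - 1) * df z"
      using f_secant[of r 1] r by auto
    then have "0 < z" "z \<le> s" using r s by (auto simp: min_less_iff_disj less_max_iff_disj)
    then have "df z \<le> 0" using df_mono[of z s] s by linarith
    have "(r - 1) * f r = (r - 1)\<^sup>2 * df z"
      using z by (simp add: f_1 power2_eq_square)
    with \<open>df z \<le> 0\<close> show ?thesis by (simp add: mult_nonneg_nonpos)
  qed simp
  have "\<forall>\<^sub>F x in at_top. v x < s"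
    by (rule order_tendstoD(2)[OF profileD(5)[OF v] s(1)])
  then obtain N where N: "\<And>x. x \<ge> N \<Longrightarrow> v x < s"
    unfolding eventually_at_top_linorder by blast
  define t where "t = max N 0"
  have "(v t - 1)\<^sup>2 \<le> (v x - 1)\<^sup>2" if "t \<le> x" for x
  proof (rule DERIV_nonneg_imp_increasing_open[OF that])
    fix y assume "t < y" "y < x"
    then have y: "0 < y" "v y \<le> s" using N[of y] by (auto simp: t_def)
    have "DERIV (\<lambda>x. (v x - 1)\<^sup>2) y :> 2 * ((v y - 1) * P (v y))"
      by (rule derivative_eq_intros profileD(4)[OF v y(1)] refl | simp)+
    moreover have "0 \<le> 2 * ((v y - 1) * P (v y))"
      using f_neg[OF profileD(3)[OF v] y(2)] y(1) lam_up
      by (simp add: P_def zero_le_divide_iff)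
    ultimately show "\<exists>d. DERIV (\<lambda>x. (v x - 1)\<^sup>2) y :> d \<and> 0 \<le> d"
      by blast
  qed (intro continuous_intros profile_continuous_on[OF v], simp add: t_def)
  then have "\<forall>\<^sub>F x in at_top. (v t - 1)\<^sup>2 \<le> (v x - 1)\<^sup>2"
    using eventually_at_top_linorder by blast
  moreover have "((\<lambda>x. (v x - 1)\<^sup>2) \<longlongrightarrow> (1 - 1)\<^sup>2) at_top"
    by (intro tendsto_intros profileD(5)[OF v])
  ultimately have "(v t - 1)\<^sup>2 \<le> (1 - 1)\<^sup>2"
    by (intro tendsto_lowerbound) auto
  then have "v t = 1" by simp
  then show ?thesis
    using profile_equilibrium[OF v _ f_1, of t 0] profileD(2)[OF v] by (simp add: t_def)
qed

text \<open>\<open>nondeg\<close> rules out the constant profile 1 at Mach number at most 1, the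
  only profile for which the conclusion fails.\<close>

lemma profile_necessary:
  assumes v: "profile v0 v" and nondeg: "mach K \<gamma> \<rho>p up > 1 \<or> v0 \<noteq> 1"
  shows "mach K \<gamma> \<rho>p up \<ge> 1" "chi_c K \<gamma> \<rho>p up < v0"
proof -
  show ge: "mach K \<gamma> \<rho>p up \<ge> 1"
    using profile_subsonic[OF v] mach_lt_1_iff nondeg by linarith
  show "chi_c K \<gamma> \<rho>p up < v0"
  proof (cases "df 1 = 0")
    case True
    then show ?thesis
      using profile_sonic_ge_1[OF v True, of 0] profileD(2)[OF v] nondeg mach_gt_1_iff
      by (simp add: chi_c_not_supersonic)
  next
    case False
    then have super: "df 1 > 0" using ge mach_ge_1_iff by simp
    let ?c = "chi_c K \<gamma> \<rho>p up"
    note chi = chi_c_supersonic[OF super]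
    show ?thesis
    proof (rule ccontr)
      assume "\<not> ?c < v0"
      then have v0: "v 0 \<le> ?c" using profileD(2)[OF v] by simp
      have "\<forall>\<^sub>F x in at_top. v x > ?c \<and> x \<ge> 0"
        using order_tendstoD(1)[OF profileD(5)[OF v] chi(2)] eventually_ge_at_top[of 0]
        by eventually_elim simp
      then obtain y where y: "0 \<le> y" "?c < v y"
        using eventually_happens'[OF trivial_limit_at_top_linorder] by blast
      \<comment> \<open>An orbit that starts at or below \<open>?c\<close> and tends to 1 must cross
        \<open>?c\<close>; being an equilibrium, \<open>?c\<close> would then hold the orbit for all
        times.\<close>
      obtain t where t: "0 \<le> t" "v t = ?c"
        using IVT'[of v 0 ?c y] v0 y profile_continuous_on[OF v, of 0 y] by auto
      have "?c = 1"
        using profile_equilibrium[OF v chi(1,3) t] by (rule profile_constant_imp_1[OF v])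
      then show False using chi(2) by simp
    qed
  qed
qed

text \<open>The unknown is the distance \<open>y\<close> to the equilibrium, with
  \<open>v = 1 + y\<close> from above and \<open>v = 1 - y\<close> from below. The sign of
  \<open>f\<close> makes \<open>y\<close> decrease, and the linear bounds on \<open>f\<close> keep
  its relative rate bounded.\<close>

lemma profile_exists:
  assumes ge: "df 1 \<ge> 0" and v0: "chi_c K \<gamma> \<rho>p up < v0"
  shows "\<exists>v. profile v0 v"
proof -
  let ?c = "chi_c K \<gamma> \<rho>p up"
  define l where "l = - (lam * up)"
  have l: "l > 0" using lam_up by (simp add: l_def)
  define L where "L = \<rho>p * up\<^sup>2 / l"
  have cont: "continuous_on S f" if "S \<subseteq> {0<..}" for S
    using that by (intro continuous_at_imp_continuous_on ballI DERIV_isCont[OF DERIV_f]) auto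
  consider "v0 = 1" | "1 < v0" | "v0 < 1" by linarith
  then show ?thesis
  proof cases
    case 1
    then have "profile v0 (\<lambda>x. 1)" by (simp add: profile_def P_def f_1)
    then show ?thesis by blast
  next
    case 2
    have "\<exists>y. y 0 = v0 - 1 \<and> continuous_on {0..} y \<and> (\<forall>x\<ge>0. 0 < y x \<and> y x \<le> v0 - 1) \<and>
        (\<forall>x>0. DERIV y x :> - (- P (1 + y x))) \<and> (y \<longlongrightarrow> 0) at_top"
    proof (rule decaying_solution_exists[where L = L])
      show "continuous_on {0<..v0 - 1} (\<lambda>y. - P (1 + y))"
        unfolding P_def using lam_up
        by (intro continuous_intros continuous_on_compose2[OF cont[OF order_refl]]) auto
      fix y :: real assume y: "0 < y" "y \<le> v0 - 1"
      have "0 < f (1 + y)" "f (1 + y) \<le> \<rho>p * up\<^sup>2 * y"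
        using f_pos_above_1[OF ge, of "1 + y"] f_le[of "1 + y"] y by auto
      then have "0 < f (1 + y) / l" "f (1 + y) / l \<le> \<rho>p * up\<^sup>2 * y / l"
        using l by (auto intro: divide_right_mono)
      moreover have "- P (1 + y) = f (1 + y) / l"
        by (simp add: P_def l_def)
      ultimately show "0 < - P (1 + y) \<and> - P (1 + y) \<le> L * y"
        by (simp add: L_def)
    qed (use 2 in auto)
    then obtain y where y: "y 0 = v0 - 1" "continuous_on {0..} y" "\<And>x. x \<ge> 0 \<Longrightarrow> 0 < y x"
      "\<And>x. x > 0 \<Longrightarrow> DERIV y x :> P (1 + y x)" "(y \<longlongrightarrow> 0) at_top"
      by auto
    have "profile v0 (\<lambda>x. 1 + y x)"
      unfolding profile_def using y tendsto_add[OF tendsto_const y(5), of 1]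
      by (auto intro!: continuous_intros derivative_eq_intros add_pos_pos)
    then show ?thesis by blast
  next
    case 3
    \<comment> \<open>A start below 1 is compatible with the hypothesis on \<open>v0\<close> only if
      \<open>?c\<close> differs from 1, which forces supersonic flow.\<close>
    have "?c < 1" using v0 3 by simp
    then have "df 1 > 0" using chi_c_not_supersonic ge by force
    note chi = chi_c_supersonic[OF this]
    have v0_pos: "0 < v0" using chi v0 by linarith
    have "\<exists>y. y 0 = 1 - v0 \<and> continuous_on {0..} y \<and> (\<forall>x\<ge>0. 0 < y x \<and> y x \<le> 1 - v0) \<and>
        (\<forall>x>0. DERIV y x :> - P (1 - y x)) \<and> (y \<longlongrightarrow> 0) at_top"
    proof (rule decaying_solution_exists[where L = L])
      show "continuous_on {0<..1 - v0} (\<lambda>y. P (1 - y))"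
        unfolding P_def using lam_up v0_pos
        by (intro continuous_intros continuous_on_compose2[OF cont[OF order_refl]]) auto
      fix y :: real assume y: "0 < y" "y \<le> 1 - v0"
      have "f (1 - y) < 0" "- f (1 - y) \<le> \<rho>p * up\<^sup>2 * y"
        using chi(4)[of "1 - y"] f_ge[of "1 - y"] y v0 v0_pos by auto
      then have "0 < - f (1 - y)" "- f (1 - y) \<le> \<rho>p * up\<^sup>2 * y" by auto
      then have "0 < - f (1 - y) / l" "- f (1 - y) / l \<le> \<rho>p * up\<^sup>2 * y / l"
        using l by (auto simp only: intro!: divide_right_mono divide_pos_pos)
      moreover have "P (1 - y) = - f (1 - y) / l"
        by (simp add: P_def l_def)
      ultimately show "0 < P (1 - y) \<and> P (1 - y) \<le> L * y"
        by (simp add: L_def)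
    qed (use 3 in auto)
    then obtain y where y: "y 0 = 1 - v0" "continuous_on {0..} y" "\<And>x. x \<ge> 0 \<Longrightarrow> y x \<le> 1 - v0"
      "\<And>x. x > 0 \<Longrightarrow> DERIV y x :> - P (1 - y x)" "(y \<longlongrightarrow> 0) at_top"
      by auto
    have pos: "0 < 1 - y x" if "x \<ge> 0" for x using y(3)[OF that] v0_pos by linarith
    have "DERIV (\<lambda>x. 1 - y x) x :> P (1 - y x)" if "x > 0" for x
      by (rule derivative_eq_intros y(4)[OF that] refl | simp)+
    then have "profile v0 (\<lambda>x. 1 - y x)"
      unfolding profile_def using y pos tendsto_diff[OF tendsto_const y(5), of 1]
      by (auto intro!: continuous_intros)
    then show ?thesis by blast
  qed
qed

section \<open>Decay rates and smoothness of profiles\<close>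

lemma profile_exp_decay:
  assumes v: "profile v0 v" and super: "df 1 > 0"
  shows "\<exists>\<sigma>>0. \<exists>C>0. \<forall>x\<ge>0. \<bar>v x - 1\<bar> \<le> C * exp (- \<sigma> * x)"
proof -
  have "\<forall>\<^sub>F r in at 1. df 1 / 2 < df r"
    using isCont_df[of 1] super by (intro order_tendstoD(1)[of df "df 1"]) (auto simp: isCont_def)
  then have "\<forall>\<^sub>F r in at_left 1. df 1 / 2 < df r"
    by (simp add: eventually_at_split)
  moreover have "\<forall>\<^sub>F r in at_left 1. r \<in> {0<..<1::real}"
    by (rule eventually_at_left_real) simp
  ultimately have "\<forall>\<^sub>F r in at_left 1. df 1 / 2 < df r \<and> r \<in> {0<..<1}"
    by (rule eventually_conj)
  then have "\<exists>r. df 1 / 2 < df r \<and> r \<in> {0<..<1}"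
    by (rule eventually_happens'[rotated]) simp
  then obtain s where s: "0 < s" "s < 1" "df 1 / 2 < df s"
    by (metis greaterThanLessThan_iff)
  \<comment> \<open>By convexity the slope bound at the single point \<open>s < 1\<close> extends to
    all states above \<open>s\<close>, however large.\<close>
  have coercive: "df 1 / 2 * (r - 1)\<^sup>2 \<le> (r - 1) * f r" if r: "s < r" for r
  proof (cases "r = 1")
    case False
    then obtain z where z: "min r 1 < z" "z < max r 1" "f r - f 1 = (r - 1) * df z"
      using f_secant[of r 1] r s by auto
    then have "s \<le> z" using r s by (auto simp: min_less_iff_disj)
    then have "df 1 / 2 \<le> df z" using df_mono[of s z] s by linarith
    then have "df 1 / 2 * (r - 1)\<^sup>2 \<le> df z * (r - 1)\<^sup>2" by (rule mult_right_mono) simp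
    also have "\<dots> = (r - 1) * f r" using z(3) by (simp add: f_1 power2_eq_square)
    finally show ?thesis .
  qed simp
  define l where "l = - (lam * up)"
  have l: "l > 0" using lam_up by (simp add: l_def)
  have P_eq: "P r = - f r / l" for r by (simp add: P_def l_def)
  define \<sigma> where "\<sigma> = df 1 / 2 / l"
  have sigma: "\<sigma> > 0" using super l by (simp add: \<sigma>_def)
  have "\<forall>\<^sub>F x in at_top. s < v x"
    by (rule order_tendstoD(1)[OF profileD(5)[OF v] s(2)])
  then obtain N where N: "\<And>x. x \<ge> N \<Longrightarrow> s < v x"
    unfolding eventually_at_top_linorder by blast
  define t where "t = max N 0"
  have t: "0 \<le> t" by (simp add: t_def)
  obtain c d where cd: "0 < c" "\<And>x. 0 \<le> x \<Longrightarrow> v x \<in> {c..d}"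
    using profile_bounded[OF v] by blast
  define m where "m = 1 + \<bar>d\<bar>"
  have m: "\<bar>v x - 1\<bar> \<le> m" if "x \<ge> 0" for x
    using cd(2)[OF that] cd(1) by (auto simp: m_def abs_le_iff)
  have m0: "m > 0" by (simp add: m_def)
  \<comment> \<open>A Lyapunov function: the growth of the weight is exactly what the coercivity
    compensates once \<open>v\<close> stays above \<open>s\<close>.\<close>
  define E where "E x = (v x - 1)\<^sup>2 * exp (2 * \<sigma> * x)" for x
  have dec: "E x \<le> E t" if "t \<le> x" for x
  proof (rule DERIV_nonpos_imp_decreasing_open[OF that])
    fix y assume "t < y" "y < x"
    then have y: "0 < y" "s < v y" using N[of y] by (auto simp: t_def)
    have "DERIV E y :> 2 * exp (2 * \<sigma> * y) * ((v y - 1) * P (v y) + \<sigma> * (v y - 1)\<^sup>2)"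
      unfolding E_def[abs_def]
      by (rule derivative_eq_intros profileD(4)[OF v y(1)] refl | simp add: algebra_simps)+
    moreover have "(v y - 1) * P (v y) + \<sigma> * (v y - 1)\<^sup>2 \<le> 0"
    proof -
      have "(v y - 1) * P (v y) + \<sigma> * (v y - 1)\<^sup>2
          = (df 1 / 2 * (v y - 1)\<^sup>2 - (v y - 1) * f (v y)) / l"
        using l by (simp add: P_eq \<sigma>_def diff_divide_distrib)
      also have "\<dots> \<le> 0"
        using coercive[OF y(2)] l by (intro divide_nonpos_pos) auto
      finally show ?thesis .
    qed
    then have "2 * exp (2 * \<sigma> * y) * ((v y - 1) * P (v y) + \<sigma> * (v y - 1)\<^sup>2) \<le> 0"
      by (rule mult_nonneg_nonpos[rotated]) simp
    ultimately show "\<exists>z. DERIV E y :> z \<and> z \<le> 0"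
      by blast
  qed (unfold E_def, intro continuous_intros profile_continuous_on[OF v] t)
  have "(v x - 1)\<^sup>2 \<le> (m * exp (\<sigma> * t) * exp (- \<sigma> * x))\<^sup>2" if x: "x \<ge> 0" for x
  proof -
    have sq: "(v y - 1)\<^sup>2 \<le> m\<^sup>2" if "y \<ge> 0" for y
      using power_mono[OF m[OF that], of 2] by simp
    \<comment> \<open>Up to time \<open>t\<close> only the crude bound \<open>m\<close> is at hand;
      the factor \<open>exp (2 * \<sigma> * t)\<close> pays for it.\<close>
    have "E x \<le> m\<^sup>2 * exp (2 * \<sigma> * t)"
    proof (cases "t \<le> x")
      case True
      have "E t \<le> m\<^sup>2 * exp (2 * \<sigma> * t)"
        using sq[OF t] by (simp add: E_def)
      then show ?thesis using dec[OF True] by linarith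
    next
      case False
      then show ?thesis
        unfolding E_def using sq[OF x] sigma by (intro mult_mono) auto
    qed
    then have "E x * exp (- 2 * \<sigma> * x) \<le> m\<^sup>2 * exp (2 * \<sigma> * t) * exp (- 2 * \<sigma> * x)"
      by (rule mult_right_mono) simp
    moreover have "E x * exp (- 2 * \<sigma> * x) = (v x - 1)\<^sup>2"
      by (simp add: E_def mult.assoc flip: exp_add)
    moreover have "m\<^sup>2 * exp (2 * \<sigma> * t) * exp (- 2 * \<sigma> * x) = (m * exp (\<sigma> * t) * exp (- \<sigma> * x))\<^sup>2"
      by (simp add: power_mult_distrib flip: exp_double) (simp add: mult_ac)
    ultimately show ?thesis by argo
  qed
  then have "\<bar>v x - 1\<bar> \<le> m * exp (\<sigma> * t) * exp (- \<sigma> * x)" if "x \<ge> 0" for x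
    using that m0 abs_le_square_iff[of "v x - 1" "m * exp (\<sigma> * t) * exp (- \<sigma> * x)"] by simp
  then show ?thesis
    using sigma m0 by (intro exI[of _ \<sigma>] conjI exI[of _ "m * exp (\<sigma> * t)"]) auto
qed

text \<open>\<open>f\<close> dominates a quadratic near its double zero, so \<open>v - 1\<close>
  satisfies a Riccati inequality and its reciprocal grows at least linearly. Taking the reciprocal
  requires \<open>v \<noteq> 1\<close>, whence the separate constant case.\<close>

lemma profile_alg_decay:
  assumes v: "profile v0 v" and sonic: "df 1 = 0"
  shows "\<exists>C>0. \<forall>x\<ge>0. \<bar>v x - 1\<bar> \<le> C / (1 + x)"
proof (cases "\<exists>t\<ge>0. v t = 1")
  case True
  then have "v x = 1" if "x \<ge> 0" for x
    using profile_equilibrium[OF v _ f_1 _ _ that] by auto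
  then show ?thesis by (intro exI[of _ 1]) auto
next
  case False
  have gt: "1 < v x" if "x \<ge> 0" for x
    using profile_sonic_ge_1[OF v sonic that] False that by (metis order_le_imp_less_or_eq)
  have le: "v x \<le> v0" if "x \<ge> 0" for x
    using profile_sonic_decreasing[OF v sonic _ that] profileD(2)[OF v] by simp
  have v0: "1 < v0" using gt[of 0] profileD(2)[OF v] by simp
  define A where "A = \<gamma> * K * \<rho>p powr \<gamma>"
  have A: "A > 0" unfolding A_def by (rule A_pos)
  have df_eq: "df r = A * (1 - r powr (- \<gamma> - 1))" for r
    using sonic by (simp add: df_def A_def algebra_simps)
  \<comment> \<open>From \<open>df r \<ge> A * (1 - 1 / r) \<ge> A * (r - 1) / v0\<close> on
    \<open>{1..v0}\<close>; integration produces the factor 2.\<close>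
  define c where "c = A / (2 * v0)"
  have c: "c > 0" using A v0 by (simp add: c_def)
  have quad: "c * (r - 1)\<^sup>2 \<le> f r" if r: "1 \<le> r" "r \<le> v0" for r
  proof -
    have "f 1 - c * (1 - 1)\<^sup>2 \<le> f r - c * (r - 1)\<^sup>2"
    proof (rule DERIV_nonneg_imp_nondecreasing[OF r(1)])
      fix z assume z: "1 \<le> z" "z \<le> r"
      then have d: "DERIV (\<lambda>r. f r - c * (r - 1)\<^sup>2) z :> df z - 2 * c * (z - 1)"
        by (auto intro!: derivative_eq_intros DERIV_f)
      have "z powr (- \<gamma> - 1) \<le> z powr (- 1)"
        using z gamma by (intro powr_mono) auto
      also have "\<dots> = 1 / z" using z by (simp add: powr_minus_divide)
      finally have "A * (1 - 1 / z) \<le> df z"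
        unfolding df_eq using A by (intro mult_left_mono) auto
      moreover have "2 * c * (z - 1) \<le> A * (1 - 1 / z)"
      proof -
        have "(z - 1) / v0 \<le> (z - 1) / z" using z r by (intro divide_left_mono) auto
        then have "A * ((z - 1) / v0) \<le> A * ((z - 1) / z)" using A by (intro mult_left_mono) auto
        moreover have "2 * c * (z - 1) = A * ((z - 1) / v0)" by (simp add: c_def)
        moreover have "(z - 1) / z = 1 - 1 / z" using z by (simp add: diff_divide_distrib)
        ultimately show ?thesis by simp
      qed
      ultimately show "\<exists>y. DERIV (\<lambda>r. f r - c * (r - 1)\<^sup>2) z :> y \<and> 0 \<le> y"
        using d by (intro exI conjI) auto
    qed
    then show ?thesis by (simp add: f_1)
  qed
  define l where "l = - (lam * up)"
  have l: "l > 0" using lam_up by (simp add: l_def)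
  have P_eq: "P r = - f r / l" for r by (simp add: P_def l_def)
  define b where "b = c / l"
  have b: "b > 0" using c l by (simp add: b_def)
  define w where "w x = 1 / (v x - 1)" for x
  have w0: "w 0 > 0" using gt[of 0] by (simp add: w_def)
  have w: "w 0 + b * x \<le> w x" if x: "x \<ge> 0" for x
  proof -
    have "w 0 - b * 0 \<le> w x - b * x"
    proof (rule DERIV_nonneg_imp_increasing_open[OF x])
      fix y assume y: "0 < y" "y < x"
      have g: "1 < v y" using gt y by simp
      have "DERIV (\<lambda>x. w x - b * x) y :> - P (v y) / (v y - 1)\<^sup>2 - b"
        unfolding w_def[abs_def] using g
        by (auto intro!: derivative_eq_intros profileD(4)[OF v y(1)] simp: power2_eq_square)
      moreover have "b \<le> - P (v y) / (v y - 1)\<^sup>2"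
      proof -
        have "c * (v y - 1)\<^sup>2 / l \<le> f (v y) / l"
          using quad[of "v y"] le[of y] g y l by (intro divide_right_mono) auto
        then have "b * (v y - 1)\<^sup>2 \<le> - P (v y)" by (simp add: b_def P_eq)
        then show ?thesis using g by (subst pos_le_divide_eq) auto
      qed
      ultimately show "\<exists>z. DERIV (\<lambda>x. w x - b * x) y :> z \<and> 0 \<le> z"
        by (intro exI conjI) auto
    qed (unfold w_def, use gt in \<open>force intro!: continuous_intros profile_continuous_on[OF v]\<close>)
    then show ?thesis by simp
  qed
  \<comment> \<open>Chosen so that \<open>w 0 + b * x \<ge> m * (1 + x)\<close>.\<close>
  define m where "m = min (w 0) b"
  have m: "m > 0" using w0 b by (simp add: m_def)
  have "\<bar>v x - 1\<bar> \<le> (1 / m) / (1 + x)" if x: "x \<ge> 0" for x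
  proof -
    have "m * (1 + x) \<le> w 0 + b * x"
      using mult_right_mono[of m b x] x by (simp add: m_def distrib_left add_mono)
    also have "\<dots> \<le> 1 / (v x - 1)" using w[OF x] by (simp add: w_def)
    finally have "m * (1 + x) * (v x - 1) \<le> 1"
      using gt[OF x] by (simp only: pos_le_divide_eq diff_gt_0_iff_gt)
    moreover have "0 < m * (1 + x)" using m x by simp
    ultimately have "v x - 1 \<le> 1 / (m * (1 + x))"
      by (simp only: pos_le_divide_eq mult.commute)
    then show ?thesis using gt[OF x] by simp
  qed
  then show ?thesis using m by (intro exI[of _ "1 / m"]) auto
qed

text \<open>The \<open>k\<close>-th derivative is the \<open>k\<close>-fold Lie derivative of
  \<open>h\<close> along the orbit, and the order of its zero at 1 becomes the exponent. For
  \<open>p = 0\<close> every derivative inherits the rate of \<open>v - 1\<close>; for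
  \<open>p = 1\<close> each derivative adds one power.\<close>

lemma profile_higher_deriv_bound:
  assumes v: "profile v0 v" and h: "smooth_on {0<..} h" "h 1 = 0"
    and phi: "\<And>x. 0 < x \<Longrightarrow> \<phi> x = h (v x)" and P: "vanishes (Suc p) 1 P"
  shows "\<exists>C\<ge>0. \<forall>x>0. \<bar>(deriv ^^ k) \<phi> x\<bar> \<le> C * \<bar>v x - 1\<bar> ^ (1 + k * p)"
proof -
  obtain c d where cd: "0 < c" "\<And>x. 0 \<le> x \<Longrightarrow> v x \<in> {c..d}"
    using profile_bounded[OF v] by blast
  \<comment> \<open>The range of the orbit is enlarged to contain 1, the point at which the order of
    vanishing is known.\<close>
  have "1 \<in> {min 1 c..max 1 d}" by simp
  moreover have "{min 1 c..max 1 d} \<subseteq> {0<..}" using cd(1) by auto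
  moreover have "vanishes (1 + k * p) 1 ((lie P ^^ k) h)"
    by (rule vanishes_lie[where S = "{0<..}"]) (use h P smooth_on_P in auto)
  moreover have "smooth_on {0<..} ((lie P ^^ k) h)"
    by (intro smooth_on_lie smooth_on_P h open_greaterThan)
  ultimately obtain C where C: "C \<ge> 0"
    "\<And>r. r \<in> {min 1 c..max 1 d} \<Longrightarrow> \<bar>(lie P ^^ k) h r\<bar> \<le> C * \<bar>r - 1\<bar> ^ (1 + k * p)"
    using vanishes_bound[OF open_greaterThan] by meson
  have "\<bar>(deriv ^^ k) \<phi> x\<bar> \<le> C * \<bar>v x - 1\<bar> ^ (1 + k * p)" if x: "x > 0" for x
  proof -
    have eq: "(deriv ^^ k) \<phi> x = (lie P ^^ k) h (v x)"
      by (rule higher_deriv_along_solution[where S = "{0<..}" and T = "{0<..}"])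
        (use x h phi smooth_on_P profileD[OF v] in auto)
    have "v x \<in> {min 1 c..max 1 d}" using cd(2)[of x] x by auto
    then show ?thesis unfolding eq by (rule C(2))
  qed
  then show ?thesis using C(1) by blast
qed

lemma profile_smooth:
  assumes v: "profile v0 v" and h: "smooth_on {0<..} h"
  shows "smooth_half_line (\<lambda>x. h (v x))"
proof -
  have "continuous_on {0<..} h"
    by (intro continuous_at_imp_continuous_on ballI DERIV_isCont[OF smooth_on_DERIV[OF open_greaterThan h]])
  then have "continuous_on {0..} (\<lambda>x. h (v x))"
    by (rule continuous_on_compose2) (use profileD[OF v] in auto)
  moreover have "smooth_on {0<..} (\<lambda>x. h (v x))"
    by (rule smooth_on_along_solution[where S = "{0<..}" and v = v and P = P and h = h])
      (use h smooth_on_P profileD[OF v] in auto)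
  ultimately show ?thesis by (simp add: smooth_half_line_def smooth_on_def)
qed

end

section \<open>Reduction of the boundary value problem\<close>

lemma smooth_half_line_iff: "smooth_half_line g \<longleftrightarrow> continuous_on {0..} g \<and> smooth_on {0<..} g"
  by (simp add: smooth_half_line_def smooth_on_def)

lemma smooth_half_line_DERIV:
  assumes "smooth_half_line g" "0 < x"
  shows "DERIV g x :> deriv g x" "DERIV (deriv g) x :> deriv (deriv g) x"
proof -
  have g: "smooth_on {0<..} g" using assms(1) by (simp add: smooth_half_line_iff)
  show "DERIV g x :> deriv g x" "DERIV (deriv g) x :> deriv (deriv g) x"
    using assms(2) smooth_on_DERIV[OF open_greaterThan g]
      smooth_on_DERIV[OF open_greaterThan smooth_on_deriv[OF g]] by auto
qed

lemma constant_on_half_line: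
  fixes g :: "real \<Rightarrow> real"
  assumes "\<And>x. 0 < x \<Longrightarrow> DERIV g x :> 0"
  shows "\<exists>c. \<forall>x>0. g x = c"
proof -
  have "\<exists>c. \<forall>x\<in>{0<..}. g x = c"
    by (rule has_field_derivative_zero_constant)
      (use assms in \<open>auto intro: has_field_derivative_at_within\<close>)
  then show ?thesis by auto
qed

lemma constant_on_closed_half_line:
  fixes g :: "real \<Rightarrow> real"
  assumes "continuous_on {0..} g" "\<And>x. 0 < x \<Longrightarrow> g x = c" "0 \<le> x"
  shows "g x = c"
  using continuous_constant_on_closure[of "{0<..}" g c x] assms by simp

text \<open>The mean value theorem on \<open>{x..x + 1}\<close> gives points tending to infinity at
  which \<open>g'\<close> equals a difference that tends to 0. This fixes the integration constant
  of the momentum equation.\<close>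

lemma tendsto_deriv_at_top_0:
  fixes g :: "real \<Rightarrow> real"
  assumes der: "\<And>x. 0 < x \<Longrightarrow> DERIV g x :> g' x" and lim: "(g \<longlongrightarrow> l) at_top" "(g' \<longlongrightarrow> L) at_top"
  shows "L = 0"
proof -
  have shift: "filterlim (\<lambda>x. x + 1 :: real) at_top at_top"
    by (rule filterlim_tendsto_add_at_top[OF tendsto_const filterlim_ident, of 1, unfolded add.commute[of 1]])
  have "\<exists>z. x < z \<and> z < x + 1 \<and> g (x + 1) - g x = g' z" if "x > 0" for x
    using MVT2[of x "x + 1" g g'] der that by auto
  then have "\<forall>x. \<exists>z. x > 0 \<longrightarrow> x < z \<and> g (x + 1) - g x = g' z" by blast
  from choice[OF this] obtain \<xi> where xi: "\<And>x. x > 0 \<Longrightarrow> x < \<xi> x \<and> g (x + 1) - g x = g' (\<xi> x)"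
    by blast
  have "\<forall>\<^sub>F x in at_top. x \<le> \<xi> x"
    using eventually_gt_at_top[of 0] by eventually_elim (use xi in force)
  then have "filterlim \<xi> at_top at_top"
    by (rule filterlim_at_top_mono[OF filterlim_ident])
  then have "((\<lambda>x. g' (\<xi> x)) \<longlongrightarrow> L) at_top"
    by (rule filterlim_compose[OF lim(2)])
  moreover have "((\<lambda>x. g' (\<xi> x)) \<longlongrightarrow> l - l) at_top"
  proof (rule Lim_transform_eventually)
    show "((\<lambda>x. g (x + 1) - g x) \<longlongrightarrow> l - l) at_top"
      by (intro tendsto_diff lim filterlim_compose[OF lim(1) shift])
    show "\<forall>\<^sub>F x in at_top. g (x + 1) - g x = g' (\<xi> x)"
      using eventually_gt_at_top[of 0] by eventually_elim (use xi in force)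
  qed
  ultimately show ?thesis
    using tendsto_unique[OF trivial_limit_at_top_linorder] by fastforce
qed

text \<open>The roots of the quadratic have product \<open>- \<mu> / \<nu> < 0\<close>, so one of
  them is positive; \<open>exp (- s * x)\<close> is the decaying mode of the microrotation.\<close>

lemma characteristic_root_exists:
  fixes m \<mu> \<nu> :: real
  assumes "\<mu> > 0" "\<nu> > 0"
  shows "\<exists>s>0. \<nu> * s\<^sup>2 = m * s + \<mu>"
proof -
  define D where "D = m\<^sup>2 + 4 * \<nu> * \<mu>"
  have D: "m\<^sup>2 < D" using assms by (simp add: D_def)
  have sq: "(sqrt D)\<^sup>2 = D" using D zero_le_power2[of m] by (intro real_sqrt_pow2) linarith
  have "\<bar>m\<bar> < sqrt D" using D by (metis real_sqrt_abs real_sqrt_less_mono)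
  then have "0 < (m + sqrt D) / (2 * \<nu>)" using assms by simp
  moreover have "\<nu> * ((m + sqrt D) / (2 * \<nu>))\<^sup>2 = m * ((m + sqrt D) / (2 * \<nu>)) + \<mu>"
    using assms sq by (simp add: D_def field_simps power2_eq_square)
  ultimately show ?thesis by blast
qed

text \<open>The operator \<open>\<nu> \<partial>\<^sup>2 + m \<partial> - \<mu>\<close> factors as \<open>\<nu> (\<partial> - r) (\<partial> + s)\<close> with \<open>r = \<mu> / (\<nu> s)\<close>.\<close>

lemma decaying_linear_solution:
  fixes \<omega> :: "real \<Rightarrow> real"
  assumes pos: "\<mu> > 0" "\<nu> > 0" "s > 0" and s: "\<nu> * s\<^sup>2 = m * s + \<mu>"
    and cont: "continuous_on {0..} \<omega>"
    and der: "\<And>x. 0 < x \<Longrightarrow> DERIV \<omega> x :> \<omega>1 x" "\<And>x. 0 < x \<Longrightarrow> DERIV \<omega>1 x :> \<omega>2 x"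
    and ode: "\<And>x. 0 < x \<Longrightarrow> - m * \<omega>1 x + \<mu> * \<omega> x = \<nu> * \<omega>2 x"
    and lim: "(\<omega> \<longlongrightarrow> 0) at_top" and x: "0 \<le> x"
  shows "\<omega> x = \<omega> 0 * exp (- s * x)"
proof -
  \<comment> \<open>The growth rate of the other mode. Both formulas for \<open>r\<close> are
    Vieta's relations.\<close>
  define r where "r = \<mu> / (\<nu> * s)"
  have r: "r > 0" using pos by (simp add: r_def)
  have rs: "r * s = \<mu> / \<nu>" using pos by (simp add: r_def)
  have r_eq: "r = s - m / \<nu>"
    using pos s by (simp add: r_def field_simps power2_eq_square)
  \<comment> \<open>Applying the factor that annihilates the decaying mode leaves the first-order
    equation \<open>z' = r * z\<close>.\<close>
  define z where "z x = \<omega>1 x + s * \<omega> x" for x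
  have z: "DERIV z x :> r * z x" if "x > 0" for x
  proof -
    have dz: "DERIV z x :> \<omega>2 x + s * \<omega>1 x"
      unfolding z_def[abs_def] by (rule derivative_eq_intros der[OF that] refl | simp)+
    have 1: "\<omega>2 x = (\<mu> * \<omega> x - m * \<omega>1 x) / \<nu>"
      using ode[OF that] pos by (simp add: field_simps)
    have 2: "r * z x = (s - m / \<nu>) * \<omega>1 x + \<mu> / \<nu> * \<omega> x"
      unfolding z_def by (simp add: distrib_left flip: r_eq rs mult.assoc)
    have eq: "\<omega>2 x + s * \<omega>1 x = r * z x"
      unfolding 1 2 by (simp add: algebra_simps diff_divide_distrib)
    show ?thesis using dz unfolding eq .
  qed
  have "DERIV (\<lambda>x. z x * exp (- r * x)) x :> 0" if "x > 0" for x
    by (rule derivative_eq_intros z[OF that] refl | simp)+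
  from constant_on_half_line[OF this] obtain c where c: "\<And>x. x > 0 \<Longrightarrow> z x * exp (- r * x) = c"
    by blast
  have z_eq: "z x = c * exp (r * x)" if "x > 0" for x
    using c[OF that] by (simp add: exp_minus field_simps)
  \<comment> \<open>Now the equation \<open>\<omega>' + s * \<omega> = c * exp (r * x)\<close> is
    integrated with the factor \<open>exp (s * x)\<close>.\<close>
  have "DERIV (\<lambda>x. \<omega> x * exp (s * x) - c / (r + s) * exp ((r + s) * x)) x :> 0" if "x > 0" for x
  proof -
    have "DERIV (\<lambda>x. \<omega> x * exp (s * x) - c / (r + s) * exp ((r + s) * x)) x
        :> \<omega>1 x * exp (s * x) + \<omega> x * (exp (s * x) * s) - c / (r + s) * (exp ((r + s) * x) * (r + s))"
      by (rule derivative_eq_intros der[OF that] refl | simp)+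
    moreover have "\<omega>1 x * exp (s * x) + \<omega> x * (exp (s * x) * s) = z x * exp (s * x)"
      by (simp add: z_def algebra_simps)
    moreover have "c / (r + s) * (exp ((r + s) * x) * (r + s)) = c * exp (r * x) * exp (s * x)"
      using r pos by (simp add: distrib_right exp_add)
    ultimately show ?thesis using z_eq[OF that] by simp
  qed
  from constant_on_half_line[OF this] obtain d where "\<And>x. x > 0 \<Longrightarrow> \<omega> x * exp (s * x) - c / (r + s) * exp ((r + s) * x) = d"
    by blast
  then have d: "\<omega> x = d * exp (- s * x) + c / (r + s) * exp (r * x)" if "x > 0" for x
  proof -
    have "\<omega> x * exp (s * x) = d + c / (r + s) * (exp (r * x) * exp (s * x))"
      using \<open>x > 0 \<Longrightarrow> _ = d\<close> that by (simp add: distrib_right exp_add)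
    then have "\<omega> x * exp (s * x) * exp (- s * x)
        = d * exp (- s * x) + c / (r + s) * exp (r * x) * (exp (s * x) * exp (- s * x))"
      by (simp add: distrib_right)
    then show ?thesis by (simp add: exp_minus mult.assoc)
  qed
  have exp0: "((\<lambda>x. exp (- a * x)) \<longlongrightarrow> 0) at_top" if "a > 0" for a :: real
    using that by (intro filterlim_compose[OF exp_at_bot] filterlim_tendsto_neg_mult_at_bot[OF tendsto_const])
      (auto intro: filterlim_ident)
  \<comment> \<open>This rescaling isolates the coefficient of the growing mode in the limit; since
    \<open>\<omega>\<close> tends to 0, it must vanish.\<close>
  have "((\<lambda>x. \<omega> x * exp (- r * x)) \<longlongrightarrow> 0 * 0) at_top"
    by (intro tendsto_mult lim exp0 r)
  moreover have "((\<lambda>x. \<omega> x * exp (- r * x)) \<longlongrightarrow> d * 0 + c / (r + s)) at_top"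
  proof (rule Lim_transform_eventually)
    show "((\<lambda>x. d * exp (- (r + s) * x) + c / (r + s)) \<longlongrightarrow> d * 0 + c / (r + s)) at_top"
      by (intro tendsto_intros exp0) (use r pos in simp)
    show "\<forall>\<^sub>F x in at_top. d * exp (- (r + s) * x) + c / (r + s) = \<omega> x * exp (- r * x)"
      using eventually_gt_at_top[of 0]
    proof eventually_elim
      case (elim x)
      have "exp (- (r + s) * x) = exp (- s * x) * exp (- r * x)" "exp (r * x) * exp (- r * x) = 1"
        by (simp_all add: algebra_simps flip: exp_add)
      then show ?case unfolding d[OF elim] by (simp add: distrib_right mult.assoc)
    qed
  qed
  ultimately have "d * 0 + c / (r + s) = 0 * 0"
    using tendsto_unique[OF trivial_limit_at_top_linorder] by blast
  then have "c = 0" using r pos by (simp add: add_nonneg_eq_0_iff)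
  then have "\<omega> x * exp (s * x) = d" if "x > 0" for x
    using d[OF that] by (simp add: exp_minus)
  moreover have "continuous_on {0..} (\<lambda>x. \<omega> x * exp (s * x))"
    by (intro continuous_intros cont)
  ultimately have const: "\<omega> x * exp (s * x) = d" if "x \<ge> 0" for x
    using constant_on_closed_half_line that by blast
  have "\<omega> 0 = d" using const[of 0] by simp
  then show ?thesis using const[OF x] by (simp add: exp_minus field_simps)
qed

lemma smooth_half_line_exp: "smooth_half_line (\<lambda>x. c * exp (s * x))"
  unfolding smooth_half_line_def higher_deriv_exp
  by (auto intro!: continuous_intros DERIV_differentiable_on derivative_eq_intros)

context viscous_flow
begin

section \<open>From the boundary value problem to profiles and back\<close>

lemma density_powr:
  assumes "0 < r"
  shows "(\<rho>p * r powr (- 1)) powr \<gamma> = \<rho>p powr \<gamma> * r powr (- \<gamma>)"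
proof -
  have "(r powr (- 1)) powr \<gamma> = r powr (- \<gamma>)"
    by (simp only: powr_powr mult_minus1)
  then show ?thesis using assms rhop by (subst powr_mult) simp_all
qed

text \<open>Every solution is expressed through its profile and one exponential, so uniqueness,
  necessity and decay all reduce to facts about profiles. The limits at infinity determine both
  integration constants.\<close>

lemma stationary_solution_reduce:
  assumes sol: "stationary_solution K \<gamma> lam \<mu> \<nu> \<rho>p up 0 ub \<omega>b \<rho> u \<omega>" and ub: "ub < 0"
    and pos: "\<mu> > 0" "\<nu> > 0" "s > 0" and s: "\<nu> * s\<^sup>2 = - (\<rho>p * up) * s + \<mu>"
  shows "profile (ub / up) (\<lambda>x. u x / up)"
    and "\<And>x. 0 \<le> x \<Longrightarrow> \<rho> x = \<rho>p * (u x / up) powr (- 1)"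
    and "\<And>x. 0 \<le> x \<Longrightarrow> \<omega> x = \<omega>b * exp (- s * x)"
proof -
  note sol' = sol[unfolded stationary_solution_def]
  have smooth: "smooth_half_line \<rho>" "smooth_half_line u" "smooth_half_line \<omega>"
    and mass: "\<And>x. x > 0 \<Longrightarrow> deriv (\<lambda>y. \<rho> y * u y) x = 0"
    and momentum: "\<And>x. x > 0 \<Longrightarrow> deriv (\<lambda>y. \<rho> y * (u y)\<^sup>2) x + deriv (\<lambda>y. pressure K \<gamma> (\<rho> y)) x
              = lam * deriv (deriv u) x"
    and spin: "\<And>x. x > 0 \<Longrightarrow> deriv (\<lambda>y. \<rho> y * u y * \<omega> y) x + \<mu> * \<omega> x = \<nu> * deriv (deriv \<omega>) x"
    and bdd: "bdd_below (\<rho> ` {0<..})" and inf: "(INF x\<in>{0<..}. \<rho> x) > 0"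
    and lim: "(\<rho> \<longlongrightarrow> \<rho>p) at_top" "(u \<longlongrightarrow> up) at_top" "(\<omega> \<longlongrightarrow> 0) at_top"
    and bc: "u 0 = ub" "\<omega> 0 = \<omega>b"
    using sol' by auto
  have cont: "continuous_on {0..} \<rho>" "continuous_on {0..} u" "continuous_on {0..} \<omega>"
    using smooth by (auto simp: smooth_half_line_def)
  note d\<rho> = smooth_half_line_DERIV(1)[OF smooth(1)]
  note du = smooth_half_line_DERIV[OF smooth(2)]
  have rho_pos: "\<rho> x > 0" if "x > 0" for x
    using inf cINF_lower[OF bdd, of x] that by simp
  have "DERIV (\<lambda>y. \<rho> y * u y) x :> 0" if "x > 0" for x
  proof -
    \<comment> \<open>An equation for \<open>deriv\<close> does not assert differentiability; the
      product rule supplies it, and then the value 0 is substituted.\<close>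
    note d = DERIV_mult[OF d\<rho>[OF that] du(1)[OF that]]
    show ?thesis using d unfolding DERIV_imp_deriv[OF d, unfolded mass[OF that], symmetric] .
  qed
  from constant_on_half_line[OF this] obtain c where c: "\<And>x. x > 0 \<Longrightarrow> \<rho> x * u x = c"
    by blast
  have "((\<lambda>x. \<rho> x * u x) \<longlongrightarrow> c) at_top"
    using c by (intro tendsto_eventually eventually_mono[OF eventually_gt_at_top[of "0::real"]])
  then have "c = \<rho>p * up"
    using tendsto_unique[OF trivial_limit_at_top_linorder _ tendsto_mult[OF lim(1,2)]] by blast
  then have flux: "\<rho> x * u x = \<rho>p * up" if "x \<ge> 0" for x
    using constant_on_closed_half_line[OF continuous_on_mult[OF cont(1,2)] c that] by simp
  have flux_neg: "\<rho>p * up < 0" using rhop up by (simp add: mult_pos_neg)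
  \<comment> \<open>The infimum condition gives a positive density only for \<open>x > 0\<close>; at
    the boundary the sign comes from \<open>ub < 0\<close>.\<close>
  have u_neg: "u x < 0" if "x \<ge> 0" for x
  proof (cases "x = 0")
    case False
    then have "\<rho> x > 0" using rho_pos that by simp
    moreover have "\<rho> x * u x < 0" using flux[OF that] flux_neg by simp
    ultimately show ?thesis by (simp add: mult_less_0_iff)
  qed (use bc ub in simp)
  define v where "v x = u x / up" for x
  have v_pos: "v x > 0" if "x \<ge> 0" for x
    using u_neg[OF that] up by (simp add: v_def divide_neg_neg)
  have u_eq: "u x = up * v x" for x using up by (simp add: v_def)
  have rho_eq: "\<rho> x = \<rho>p * v x powr (- 1)" if "x \<ge> 0" for x
    using flux[OF that] v_pos[OF that] up by (simp add: u_eq powr_minus_divide field_simps)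
  show "\<rho> x = \<rho>p * (u x / up) powr (- 1)" if "x \<ge> 0" for x
    using rho_eq[OF that] by (simp add: v_def)

  define G where "G x = \<rho> x * (u x)\<^sup>2 + pressure K \<gamma> (\<rho> x)" for x
  have "DERIV (\<lambda>x. lam * deriv u x - G x) x :> 0" if "x > 0" for x
  proof -
    have d1: "DERIV (\<lambda>y. \<rho> y * (u y)\<^sup>2) x :> deriv (\<lambda>y. \<rho> y * (u y)\<^sup>2) x"
      unfolding DERIV_deriv_iff_real_differentiable
      using d\<rho>[OF that] du(1)[OF that]
      by (intro derivative_intros) (auto simp: real_differentiable_def)
    have d2: "DERIV (\<lambda>y. pressure K \<gamma> (\<rho> y)) x :> K * (\<gamma> * \<rho> x powr (\<gamma> - 1) * deriv \<rho> x)"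
      unfolding pressure_def
      by (intro DERIV_cmult DERIV_chain2[OF has_real_derivative_powr] d\<rho> that rho_pos)
    have "DERIV G x :> deriv (\<lambda>y. \<rho> y * (u y)\<^sup>2) x + deriv (\<lambda>y. pressure K \<gamma> (\<rho> y)) x"
      unfolding G_def[abs_def] DERIV_imp_deriv[OF d2] by (rule DERIV_add[OF d1 d2])
    then show ?thesis
      using DERIV_diff[OF DERIV_cmult[OF du(2)[OF that], of lam]] momentum[OF that] by fastforce
  qed
  from constant_on_half_line[OF this] obtain e where e: "\<And>x. x > 0 \<Longrightarrow> lam * deriv u x - G x = e"
    by blast
  define Gp where "Gp = \<rho>p * up\<^sup>2 + K * \<rho>p powr \<gamma>"
  have "(G \<longlongrightarrow> Gp) at_top"
    unfolding G_def Gp_def pressure_def using rhop by (intro tendsto_intros lim) auto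
  then have "((\<lambda>x. (G x + e) / lam) \<longlongrightarrow> (Gp + e) / lam) at_top"
    using lam by (intro tendsto_intros) auto
  moreover have du_eq: "deriv u x = (G x + e) / lam" if "x > 0" for x
    using e[OF that] lam by (simp add: field_simps)
  then have "DERIV u x :> (G x + e) / lam" if "x > 0" for x
    using du(1)[OF that] that by simp
  \<comment> \<open>\<open>u\<close> converges and its derivative has a limit, so that limit is
    0.\<close>
  ultimately have "(Gp + e) / lam = 0"
    by (rule tendsto_deriv_at_top_0[OF _ lim(2), rotated])
  then have e_eq: "e = - Gp" using lam by simp
  have G_eq: "G x - Gp = f (v x)" if "x \<ge> 0" for x
  proof -
    have v: "v x > 0" by (rule v_pos[OF that])
    have "\<rho> x * (u x)\<^sup>2 = \<rho>p * up\<^sup>2 * v x"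
      using flux[OF that] by (simp add: power2_eq_square u_eq flip: mult.assoc)
    moreover have "\<rho> x powr \<gamma> = \<rho>p powr \<gamma> * v x powr (- \<gamma>)"
      unfolding rho_eq[OF that] by (rule density_powr[OF v])
    ultimately show ?thesis
      by (simp add: G_def Gp_def F_def pressure_def algebra_simps)
  qed
  have "DERIV v x :> P (v x)" if "x > 0" for x
  proof -
    have "DERIV v x :> deriv u x / up"
      unfolding v_def[abs_def] by (intro DERIV_cdivide du(1) that)
    moreover have "deriv u x = f (v x) / lam"
      using du_eq[OF that] G_eq[of x] that by (simp add: e_eq)
    ultimately show ?thesis by (simp add: P_def)
  qed
  moreover have "(v \<longlongrightarrow> up / up) at_top"
    unfolding v_def using up by (intro tendsto_intros lim) auto
  ultimately have "profile (ub / up) v"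
    unfolding profile_def using v_pos bc up cont by (auto simp: v_def intro!: continuous_intros)
  then show "profile (ub / up) (\<lambda>x. u x / up)"
    by (simp add: v_def[abs_def])

  show "\<omega> x = \<omega>b * exp (- s * x)" if "x \<ge> 0" for x
    unfolding bc(2)[symmetric]
  proof (rule decaying_linear_solution[OF pos s cont(3) smooth_half_line_DERIV[OF smooth(3)] _ lim(3) that])
    fix x :: real assume x: "x > 0"
    have "deriv (\<lambda>y. \<rho> y * u y * \<omega> y) x = deriv (\<lambda>y. \<rho>p * up * \<omega> y) x"
      using x flux by (intro deriv_cong_on[of "{0<..}"]) auto
    also have "\<dots> = \<rho>p * up * deriv \<omega> x"
      by (intro DERIV_imp_deriv DERIV_cmult smooth_half_line_DERIV smooth x)
    finally show "- (- (\<rho>p * up)) * deriv \<omega> x + \<mu> * \<omega> x = \<nu> * deriv (deriv \<omega>) x"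
      using spin[OF x] by simp
  qed
qed

text \<open>The shift \<open>c\<close> is 0 for the fields themselves and \<open>- \<rho>p\<close>
  for the deviation, which vanishes at \<open>r = 1\<close>; the velocity is treated alike with
  \<open>- up\<close>.\<close>

lemma smooth_on_density: "smooth_on {0<..} (\<lambda>r. \<rho>p * r powr (- 1) + c)"
  by (intro smooth_on_add smooth_on_mult smooth_on_const smooth_on_powr open_greaterThan)

lemma smooth_on_velocity: "smooth_on {0<..} (\<lambda>r. up * r + c)"
proof (rule smooth_on_DERIVI[where g = "\<lambda>r. up"])
  show "DERIV (\<lambda>r. up * r + c) r :> up" for r
    by (rule derivative_eq_intros refl | simp)+
qed (simp_all add: smooth_on_const)

lemma stationary_solution_of_profile:
  assumes v: "profile v0 v" and s: "s > 0" "\<nu> * s\<^sup>2 = - (\<rho>p * up) * s + \<mu>"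
  shows "stationary_solution K \<gamma> lam \<mu> \<nu> \<rho>p up 0 (up * v0) \<omega>b
    (\<lambda>x. \<rho>p * v x powr (- 1)) (\<lambda>x. up * v x) (\<lambda>x. \<omega>b * exp (- s * x))"
proof -
  let ?\<rho> = "\<lambda>x. \<rho>p * v x powr (- 1)" and ?u = "\<lambda>x. up * v x" and ?\<omega> = "\<lambda>x. \<omega>b * exp (- s * x)"
  note prof = profileD[OF v]
  have flux: "?\<rho> x * ?u x = \<rho>p * up" if "x > 0" for x
    using prof(3)[of x] that by (simp add: powr_minus_divide)
  obtain c d where cd: "0 < c" "\<And>x. 0 \<le> x \<Longrightarrow> v x \<in> {c..d}"
    using profile_bounded[OF v] by blast
  have "smooth_half_line ?\<rho>"
    using profile_smooth[OF v smooth_on_density[of 0]] by simp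
  moreover have "smooth_half_line ?u"
    using profile_smooth[OF v smooth_on_velocity[of 0]] by simp
  moreover have "smooth_half_line ?\<omega>"
    by (rule smooth_half_line_exp)
  moreover have "deriv (\<lambda>y. ?\<rho> y * ?u y) x = 0" if "x > 0" for x
    using that flux deriv_cong_on[of "{0<..}" x "\<lambda>y. ?\<rho> y * ?u y" "\<lambda>y. \<rho>p * up"] by simp
  moreover have "deriv (\<lambda>y. ?\<rho> y * (?u y)\<^sup>2) x + deriv (\<lambda>y. pressure K \<gamma> (?\<rho> y)) x
      = lam * deriv (deriv ?u) x" if x: "x > 0" for x
  proof -
    have vx: "v x > 0" using prof(3)[of x] x by simp
    note dv = prof(4)[OF x]
    have "deriv (\<lambda>y. ?\<rho> y * (?u y)\<^sup>2) x = deriv (\<lambda>y. \<rho>p * up\<^sup>2 * v y) x"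
      using x prof(3)
      by (intro deriv_cong_on[of "{0<..}"]) (auto simp: power2_eq_square powr_minus_divide less_imp_le less_imp_neq[THEN not_sym])
    also have "\<dots> = \<rho>p * up\<^sup>2 * P (v x)"
      by (intro DERIV_imp_deriv DERIV_cmult dv)
    finally have 1: "deriv (\<lambda>y. ?\<rho> y * (?u y)\<^sup>2) x = \<rho>p * up\<^sup>2 * P (v x)" .
    have "deriv (\<lambda>y. pressure K \<gamma> (?\<rho> y)) x = deriv (\<lambda>y. K * \<rho>p powr \<gamma> * v y powr (- \<gamma>)) x"
      using x prof(3)
      by (intro deriv_cong_on[of "{0<..}"]) (auto simp only: pressure_def density_powr greaterThan_iff open_greaterThan less_imp_le mult.assoc)
    also have "\<dots> = K * \<rho>p powr \<gamma> * (- \<gamma> * v x powr (- \<gamma> - 1) * P (v x))"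
      by (intro DERIV_imp_deriv DERIV_cmult DERIV_chain2[OF has_real_derivative_powr] dv vx)
    finally have 2: "deriv (\<lambda>y. pressure K \<gamma> (?\<rho> y)) x
        = K * \<rho>p powr \<gamma> * (- \<gamma> * v x powr (- \<gamma> - 1) * P (v x))" .
    \<comment> \<open>The profile equation is the integrated momentum balance. Its derivative gives
      \<open>df (v x) * P (v x)\<close>, which is also the sum of the two fluxes computed
      above.\<close>
    have "deriv ?u y = f (v y) / lam" if "y \<in> {0<..}" for y
    proof -
      have "deriv ?u y = up * P (v y)"
        using that by (intro DERIV_imp_deriv DERIV_cmult prof(4)) auto
      then show ?thesis using up by (simp add: P_def)
    qed
    then have "deriv (deriv ?u) x = deriv (\<lambda>y. f (v y) / lam) x"
      using x by (intro deriv_cong_on[of "{0<..}"]) auto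
    also have "\<dots> = df (v x) * P (v x) / lam"
      by (intro DERIV_imp_deriv DERIV_cdivide DERIV_chain2[OF DERIV_f] dv vx)
    finally have "lam * deriv (deriv ?u) x = df (v x) * P (v x)"
      using lam by simp
    then show ?thesis
      unfolding 1 2 by (simp add: df_def algebra_simps)
  qed
  moreover have "deriv (\<lambda>y. ?\<rho> y * ?u y * ?\<omega> y) x + \<mu> * ?\<omega> x = \<nu> * deriv (deriv ?\<omega>) x"
    if x: "x > 0" for x
  proof -
    have "?\<rho> y * ?u y * ?\<omega> y = \<rho>p * up * \<omega>b * exp (- s * y)" if "y \<in> {0<..}" for y
      using flux[of y] that by (simp only: greaterThan_iff mult.assoc[symmetric])
    then have "deriv (\<lambda>y. ?\<rho> y * ?u y * ?\<omega> y) x = deriv (\<lambda>y. (\<rho>p * up * \<omega>b) * exp (- s * y)) x"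
      using x by (intro deriv_cong_on[of "{0<..}"]) auto
    also have "\<dots> = \<rho>p * up * \<omega>b * - s * exp (- s * x)"
      using higher_deriv_exp[of 1 "\<rho>p * up * \<omega>b" "- s"] by simp
    finally have 1: "deriv (\<lambda>y. ?\<rho> y * ?u y * ?\<omega> y) x = - (\<rho>p * up) * s * ?\<omega> x"
      by simp
    have "deriv (deriv ?\<omega>) x = s\<^sup>2 * ?\<omega> x"
      using higher_deriv_exp[of 2 \<omega>b "- s"] by (simp add: numeral_2_eq_2)
    then have "\<nu> * deriv (deriv ?\<omega>) x = (\<nu> * s\<^sup>2) * ?\<omega> x" by simp
    then show ?thesis unfolding 1 s(2) by (simp add: algebra_simps)
  qed
  moreover have "bdd_below (?\<rho> ` {0<..})" "(INF x\<in>{0<..}. ?\<rho> x) > 0"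
  proof -
    have d: "d > 0" using cd(2)[of 0] cd(1) by simp
    \<comment> \<open>The upper bound \<open>d\<close> on \<open>v\<close> becomes a positive lower
      bound on the density.\<close>
    have le: "\<rho>p / d \<le> ?\<rho> x" if "x \<in> {0<..}" for x
    proof -
      have "v x > 0" "v x \<le> d" using cd that by (auto intro: prof(3))
      then have "\<rho>p / d \<le> \<rho>p / v x" using rhop by (intro divide_left_mono) auto
      then show ?thesis using \<open>v x > 0\<close> by (simp add: powr_minus_divide)
    qed
    then show "bdd_below (?\<rho> ` {0<..})" by (rule bdd_belowI2)
    have "\<rho>p / d \<le> (INF x\<in>{0<..}. ?\<rho> x)"
      by (rule cINF_greatest) (use le in auto)
    moreover have "0 < \<rho>p / d" using rhop d by simp
    ultimately show "(INF x\<in>{0<..}. ?\<rho> x) > 0" by linarith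
  qed
  moreover have "(?\<rho> \<longlongrightarrow> \<rho>p * 1 powr (- 1)) at_top" "(?u \<longlongrightarrow> up * 1) at_top"
    by (intro tendsto_intros prof(5); simp)+
  moreover have "(?\<omega> \<longlongrightarrow> \<omega>b * 0) at_top"
    using s(1) by (intro tendsto_intros filterlim_compose[OF exp_at_bot]
        filterlim_tendsto_neg_mult_at_bot[OF tendsto_const]) (auto intro: filterlim_ident)
  ultimately show ?thesis
    unfolding stationary_solution_def using prof(2) by simp
qed

lemma profile_deriv_bounds:
  assumes v: "profile v0 v" and \<rho>: "\<And>x. 0 < x \<Longrightarrow> \<rho> x = \<rho>p * v x powr (- 1)"
    and u: "\<And>x. 0 < x \<Longrightarrow> u x = up * v x" and P: "vanishes (Suc p) 1 P"
  shows "\<exists>C\<ge>0. \<forall>x>0. \<bar>(deriv ^^ k) (\<lambda>y. \<rho> y - \<rho>p) x\<bar> + \<bar>(deriv ^^ k) (\<lambda>y. u y - up) x\<bar>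
    \<le> C * \<bar>v x - 1\<bar> ^ (1 + k * p)"
proof -
  obtain C1 where C1: "C1 \<ge> 0"
    "\<And>x. x > 0 \<Longrightarrow> \<bar>(deriv ^^ k) (\<lambda>y. \<rho> y - \<rho>p) x\<bar> \<le> C1 * \<bar>v x - 1\<bar> ^ (1 + k * p)"
    using profile_higher_deriv_bound[OF v smooth_on_density[of "- \<rho>p"] _ _ P, of "\<lambda>y. \<rho> y - \<rho>p" k] \<rho>
    by auto
  obtain C2 where C2: "C2 \<ge> 0"
    "\<And>x. x > 0 \<Longrightarrow> \<bar>(deriv ^^ k) (\<lambda>y. u y - up) x\<bar> \<le> C2 * \<bar>v x - 1\<bar> ^ (1 + k * p)"
    using profile_higher_deriv_bound[OF v smooth_on_velocity[of "- up"] _ _ P, of "\<lambda>y. u y - up" k] u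
    by auto
  show ?thesis
    using C1(1) C2(1) add_mono[OF C1(2) C2(2)]
    by (intro exI[of _ "C1 + C2"]) (auto simp: distrib_right)
qed

end

section \<open>Well-posedness and decay for the full system\<close>

lemma exp_solution_deriv_bound:
  fixes \<omega> :: "real \<Rightarrow> real"
  assumes "\<And>x. 0 \<le> x \<Longrightarrow> \<omega> x = c * exp (- s * x)" "0 < x" "0 < s"
  shows "\<bar>(deriv ^^ k) (\<lambda>y. \<omega> y - 0) x\<bar> = \<bar>c\<bar> * s ^ k * exp (- s * x)"
proof -
  have "(deriv ^^ k) (\<lambda>y. \<omega> y - 0) x = (deriv ^^ k) (\<lambda>x. c * exp (- s * x)) x"
    using assms by (intro higher_deriv_cong_on[of "{0<..}"]) auto
  then show ?thesis
    using assms(3) unfolding higher_deriv_exp by (simp add: abs_mult power_abs)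
qed

theorem theorem1p1:
  fixes K \<gamma> lam \<mu> \<nu> \<rho>p up \<omega>p ub \<omega>b \<delta> :: real
  assumes "\<gamma> \<ge> 1" "K > 0" "lam > 0" "\<mu> > 0" "\<nu> > 0"
    and "\<rho>p > 0" "up < 0" "ub < 0" "\<omega>b \<noteq> 0" "\<omega>p = 0"
    and nondegenerate: "mach K \<gamma> \<rho>p up > 1 \<or> ub \<noteq> up"
    and "\<delta> = max \<bar>\<omega>b\<bar> \<bar>ub - up\<bar>"
  shows
    "((\<exists>\<rho> u \<omega>. stationary_solution K \<gamma> lam \<mu> \<nu> \<rho>p up \<omega>p ub \<omega>b \<rho> u \<omega> \<and>
         (\<forall>\<rho>' u' \<omega>'. stationary_solution K \<gamma> lam \<mu> \<nu> \<rho>p up \<omega>p ub \<omega>b \<rho>' u' \<omega>' \<longrightarrow>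
            (\<forall>x\<ge>0. \<rho>' x = \<rho> x \<and> u' x = u x \<and> \<omega>' x = \<omega> x)))
      \<longleftrightarrow> mach K \<gamma> \<rho>p up \<ge> 1 \<and> chi_c K \<gamma> \<rho>p up * up > ub)
   \<and>
     (mach K \<gamma> \<rho>p up > 1 \<longrightarrow>
      (\<forall>\<rho> u \<omega>. stationary_solution K \<gamma> lam \<mu> \<nu> \<rho>p up \<omega>p ub \<omega>b \<rho> u \<omega> \<longrightarrow>
        (\<exists>\<sigma>>0. \<forall>k. \<exists>C>0. \<forall>x>0.
          norm ((deriv ^^ k) (\<lambda>y. \<rho> y - \<rho>p) x,
                (deriv ^^ k) (\<lambda>y. u y - up) x,
                (deriv ^^ k) (\<lambda>y. \<omega> y - \<omega>p) x) \<le> C * \<delta> * exp (- \<sigma> * x))))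
   \<and>
     (mach K \<gamma> \<rho>p up = 1 \<longrightarrow>
      (\<forall>\<rho> u \<omega>. stationary_solution K \<gamma> lam \<mu> \<nu> \<rho>p up \<omega>p ub \<omega>b \<rho> u \<omega> \<longrightarrow>
        (\<exists>\<sigma>>0. \<forall>k. \<exists>C>0. \<forall>x>0.
          norm ((deriv ^^ k) (\<lambda>y. \<rho> y - \<rho>p) x,
                (deriv ^^ k) (\<lambda>y. u y - up) x)
            \<le> C * (\<delta> ^ (k + 1) / (1 + \<delta> * x) ^ (k + 1)) \<and>
          \<bar>(deriv ^^ k) (\<lambda>y. \<omega> y - \<omega>p) x\<bar> \<le> C * \<delta> * exp (- \<sigma> * x))))"
proof -
  interpret viscous_flow K \<gamma> lam \<rho>p up
    by standard (use assms in auto)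
  \<comment> \<open>Positive because \<open>\<omega>b \<noteq> 0\<close>, even when
    \<open>ub = up\<close>; this permits the divisions by \<open>\<delta>\<close> below.\<close>
  have delta: "\<delta> > 0" using assms by (simp add: less_max_iff_disj)
  have up_neg: "up < 0" by fact
  obtain s where s: "s > 0" "\<nu> * s\<^sup>2 = - (\<rho>p * up) * s + \<mu>"
    using characteristic_root_exists[OF \<open>\<mu> > 0\<close> \<open>\<nu> > 0\<close>] by blast
  let ?sol = "stationary_solution K \<gamma> lam \<mu> \<nu> \<rho>p up \<omega>p ub \<omega>b"
  note reduce = stationary_solution_reduce[OF _ \<open>ub < 0\<close> \<open>\<mu> > 0\<close> \<open>\<nu> > 0\<close> s]
  have cond: "chi_c K \<gamma> \<rho>p up * up > ub \<longleftrightarrow> chi_c K \<gamma> \<rho>p up < ub / up"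
    using up_neg by (simp add: neg_less_divide_eq)
  have "\<exists>\<rho> u \<omega>. ?sol \<rho> u \<omega> \<and>
      (\<forall>\<rho>' u' \<omega>'. ?sol \<rho>' u' \<omega>' \<longrightarrow> (\<forall>x\<ge>0. \<rho>' x = \<rho> x \<and> u' x = u x \<and> \<omega>' x = \<omega> x))"
    if ge: "mach K \<gamma> \<rho>p up \<ge> 1" and less: "chi_c K \<gamma> \<rho>p up * up > ub"
  proof -
    obtain v where v: "profile (ub / up) v"
      using profile_exists ge less cond mach_ge_1_iff by blast
    let ?\<rho> = "\<lambda>x. \<rho>p * v x powr (- 1)" and ?u = "\<lambda>x. up * v x" and ?\<omega> = "\<lambda>x. \<omega>b * exp (- s * x)"
    have "?sol ?\<rho> ?u ?\<omega>"
      using stationary_solution_of_profile[OF v s, of \<omega>b] up_neg \<open>\<omega>p = 0\<close> by simp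
    moreover have "\<rho>' x = ?\<rho> x \<and> u' x = ?u x \<and> \<omega>' x = ?\<omega> x"
      if sol: "?sol \<rho>' u' \<omega>'" and x: "x \<ge> 0" for \<rho>' u' \<omega>' x
    proof -
      have "u' x / up = v x" by (rule profile_unique[OF reduce(1)[OF sol[unfolded \<open>\<omega>p = 0\<close>]] v x])
      then show ?thesis
        using reduce(2,3)[OF sol[unfolded \<open>\<omega>p = 0\<close>] x] up_neg by (auto simp: field_simps)
    qed
    ultimately show ?thesis by blast
  qed
  \<comment> \<open>Any solution, whether or not it is known to be unique, already forces the
    conditions.\<close>
  moreover have "mach K \<gamma> \<rho>p up \<ge> 1 \<and> chi_c K \<gamma> \<rho>p up * up > ub" if sol: "?sol \<rho> u \<omega>" for \<rho> u \<omega>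
  proof -
    have "mach K \<gamma> \<rho>p up > 1 \<or> ub / up \<noteq> 1"
      using nondegenerate up_neg by auto
    then show ?thesis
      unfolding cond using profile_necessary[OF reduce(1)[OF sol[unfolded \<open>\<omega>p = 0\<close>]]] by blast
  qed
  moreover have "\<exists>\<sigma>>0. \<forall>k. \<exists>C>0. \<forall>x>0.
          norm ((deriv ^^ k) (\<lambda>y. \<rho> y - \<rho>p) x, (deriv ^^ k) (\<lambda>y. u y - up) x,
                (deriv ^^ k) (\<lambda>y. \<omega> y - \<omega>p) x) \<le> C * \<delta> * exp (- \<sigma> * x)"
    if super: "mach K \<gamma> \<rho>p up > 1" and sol: "?sol \<rho> u \<omega>" for \<rho> u \<omega>
  proof -
    note v = reduce(1)[OF sol[unfolded \<open>\<omega>p = 0\<close>]]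
    obtain \<sigma>1 C1 where C1: "\<sigma>1 > 0" "C1 > 0" "\<And>x. x \<ge> 0 \<Longrightarrow> \<bar>u x / up - 1\<bar> \<le> C1 * exp (- \<sigma>1 * x)"
      using profile_exp_decay[OF v] super mach_gt_1_iff by blast
    \<comment> \<open>The slower of the fluid rate and the microrotation rate, chosen before
      \<open>k\<close>.\<close>
    define \<sigma> where "\<sigma> = min \<sigma>1 s"
    have "\<exists>C>0. \<forall>x>0. norm ((deriv ^^ k) (\<lambda>y. \<rho> y - \<rho>p) x, (deriv ^^ k) (\<lambda>y. u y - up) x,
                (deriv ^^ k) (\<lambda>y. \<omega> y - \<omega>p) x) \<le> C * \<delta> * exp (- \<sigma> * x)" for k
    proof -
      have P: "vanishes (Suc 0) 1 P" using vanishes_P by simp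
      obtain C2 where C2: "C2 \<ge> 0"
        "\<And>x. x > 0 \<Longrightarrow> \<bar>(deriv ^^ k) (\<lambda>y. \<rho> y - \<rho>p) x\<bar> + \<bar>(deriv ^^ k) (\<lambda>y. u y - up) x\<bar> \<le> C2 * \<bar>u x / up - 1\<bar>"
        using profile_deriv_bounds[OF v _ _ P, of \<rho> u k] reduce(2)[OF sol[unfolded \<open>\<omega>p = 0\<close>]] up_neg by auto
      \<comment> \<open>The data are fixed at this point, so the factor \<open>\<delta>\<close> is
        inserted by using \<open>C / \<delta>\<close> as the final constant.\<close>
      define C where "C = C2 * C1 + \<bar>\<omega>b\<bar> * s ^ k"
      have C: "C > 0"
        using C1 C2 s assms by (simp add: C_def add_nonneg_pos)
      have "norm ((deriv ^^ k) (\<lambda>y. \<rho> y - \<rho>p) x, (deriv ^^ k) (\<lambda>y. u y - up) x,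
                (deriv ^^ k) (\<lambda>y. \<omega> y - \<omega>p) x) \<le> C / \<delta> * \<delta> * exp (- \<sigma> * x)" (is "norm (?a, ?b, ?c) \<le> _")
        if x: "x > 0" for x
      proof -
        have e: "exp (- \<sigma>1 * x) \<le> exp (- \<sigma> * x)" "exp (- s * x) \<le> exp (- \<sigma> * x)"
          using x by (simp_all add: \<sigma>_def)
        have "norm (?a, ?b, ?c) \<le> \<bar>?a\<bar> + norm (?b, ?c)"
          using norm_Pair_le[of ?a "(?b, ?c)"] by simp
        also have "\<dots> \<le> \<bar>?a\<bar> + \<bar>?b\<bar> + \<bar>?c\<bar>"
          using norm_Pair_le[of ?b ?c] by simp
        also have "\<dots> \<le> C2 * (C1 * exp (- \<sigma>1 * x)) + \<bar>\<omega>b\<bar> * s ^ k * exp (- s * x)"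
        proof (rule add_mono)
          show "\<bar>?a\<bar> + \<bar>?b\<bar> \<le> C2 * (C1 * exp (- \<sigma>1 * x))"
            using C2(2)[OF x] mult_left_mono[OF C1(3)[OF less_imp_le[OF x]] C2(1)] by linarith
          show "\<bar>?c\<bar> \<le> \<bar>\<omega>b\<bar> * s ^ k * exp (- s * x)"
            using exp_solution_deriv_bound[OF reduce(3)[OF sol[unfolded \<open>\<omega>p = 0\<close>]] x s(1), of k] \<open>\<omega>p = 0\<close> by simp
        qed
        also have "\<dots> \<le> C2 * (C1 * exp (- \<sigma> * x)) + \<bar>\<omega>b\<bar> * s ^ k * exp (- \<sigma> * x)"
          using e C1 C2 s by (intro add_mono mult_left_mono) auto
        also have "\<dots> = C / \<delta> * \<delta> * exp (- \<sigma> * x)"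
          using delta by (simp add: C_def field_simps)
        finally show ?thesis .
      qed
      then show ?thesis using C delta by (intro exI[of _ "C / \<delta>"]) auto
    qed
    then show ?thesis using C1 s by (intro exI[of _ \<sigma>]) (auto simp: \<sigma>_def)
  qed
  moreover have "\<exists>\<sigma>>0. \<forall>k. \<exists>C>0. \<forall>x>0.
          norm ((deriv ^^ k) (\<lambda>y. \<rho> y - \<rho>p) x, (deriv ^^ k) (\<lambda>y. u y - up) x)
            \<le> C * (\<delta> ^ (k + 1) / (1 + \<delta> * x) ^ (k + 1)) \<and>
          \<bar>(deriv ^^ k) (\<lambda>y. \<omega> y - \<omega>p) x\<bar> \<le> C * \<delta> * exp (- \<sigma> * x)"
    if sonic: "mach K \<gamma> \<rho>p up = 1" and sol: "?sol \<rho> u \<omega>" for \<rho> u \<omega>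
  proof -
    note v = reduce(1)[OF sol[unfolded \<open>\<omega>p = 0\<close>]]
    obtain C1 where C1: "C1 > 0" "\<And>x. x \<ge> 0 \<Longrightarrow> \<bar>u x / up - 1\<bar> \<le> C1 / (1 + x)"
      using profile_alg_decay[OF v] sonic mach_eq_1_iff by blast
    have P: "vanishes (Suc 1) 1 P" using vanishes_P_sonic sonic mach_eq_1_iff by (simp add: numeral_2_eq_2)
    \<comment> \<open>The factor converts decay in \<open>1 + x\<close> into decay in
      \<open>1 + \<delta> * x\<close>, by
      \<open>1 + \<delta> * x \<le> (1 + \<delta>) * (1 + x)\<close>.\<close>
    define M where "M = C1 * (1 + 1 / \<delta>)"
    have M: "M > 0" using C1 delta by (simp add: M_def add_pos_pos)
    have decay: "\<bar>u x / up - 1\<bar> \<le> M * (\<delta> / (1 + \<delta> * x))" if x: "x > 0" for x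
    proof -
      have "1 / (1 + x) \<le> (1 + 1 / \<delta>) * (\<delta> / (1 + \<delta> * x))"
        using x delta by (simp add: field_simps add_pos_pos)
      then have "C1 * (1 / (1 + x)) \<le> C1 * ((1 + 1 / \<delta>) * (\<delta> / (1 + \<delta> * x)))"
        using C1 by (intro mult_left_mono) auto
      then show ?thesis using C1(2)[of x] x by (simp add: M_def mult.assoc)
    qed
    have "\<exists>C>0. \<forall>x>0. norm ((deriv ^^ k) (\<lambda>y. \<rho> y - \<rho>p) x, (deriv ^^ k) (\<lambda>y. u y - up) x)
            \<le> C * (\<delta> ^ (k + 1) / (1 + \<delta> * x) ^ (k + 1)) \<and>
          \<bar>(deriv ^^ k) (\<lambda>y. \<omega> y - \<omega>p) x\<bar> \<le> C * \<delta> * exp (- s * x)" for k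
    proof -
      obtain C2 where C2: "C2 \<ge> 0"
        "\<And>x. x > 0 \<Longrightarrow> \<bar>(deriv ^^ k) (\<lambda>y. \<rho> y - \<rho>p) x\<bar> + \<bar>(deriv ^^ k) (\<lambda>y. u y - up) x\<bar>
           \<le> C2 * \<bar>u x / up - 1\<bar> ^ (k + 1)"
        using profile_deriv_bounds[OF v _ _ P, of \<rho> u k] reduce(2)[OF sol[unfolded \<open>\<omega>p = 0\<close>]] up_neg by auto
      \<comment> \<open>One constant must serve both estimates, hence the sum. Only the
        microrotation part is divided by \<open>\<delta>\<close>; for the fluid part the powers of
        \<open>\<delta>\<close> already come from \<open>decay\<close>.\<close>
      define C where "C = C2 * M ^ (k + 1) + \<bar>\<omega>b\<bar> * s ^ k / \<delta>"
      have nonneg: "0 \<le> C2 * M ^ (k + 1)" "0 < \<bar>\<omega>b\<bar> * s ^ k / \<delta>"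
        using C2 M s delta assms by auto
      have C: "C > 0" "C2 * M ^ (k + 1) \<le> C" "\<bar>\<omega>b\<bar> * s ^ k / \<delta> \<le> C"
        using nonneg unfolding C_def by linarith+
      have "norm ((deriv ^^ k) (\<lambda>y. \<rho> y - \<rho>p) x, (deriv ^^ k) (\<lambda>y. u y - up) x)
            \<le> C * (\<delta> ^ (k + 1) / (1 + \<delta> * x) ^ (k + 1))" (is "norm (?a, ?b) \<le> _")
        if x: "x > 0" for x
      proof -
        have "norm (?a, ?b) \<le> \<bar>?a\<bar> + \<bar>?b\<bar>"
          using norm_Pair_le[of ?a ?b] by simp
        also have "\<dots> \<le> C2 * \<bar>u x / up - 1\<bar> ^ (k + 1)" by (rule C2(2)[OF x])
        also have "\<dots> \<le> C2 * (M * (\<delta> / (1 + \<delta> * x))) ^ (k + 1)"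
          using C2(1) decay[OF x] by (intro mult_left_mono power_mono) auto
        also have "\<dots> = C2 * M ^ (k + 1) * (\<delta> ^ (k + 1) / (1 + \<delta> * x) ^ (k + 1))"
          by (simp only: power_mult_distrib power_divide mult.assoc)
        also have "\<dots> \<le> C * (\<delta> ^ (k + 1) / (1 + \<delta> * x) ^ (k + 1))"
          using C(2) delta x by (intro mult_right_mono) auto
        finally show ?thesis .
      qed
      moreover have "\<bar>(deriv ^^ k) (\<lambda>y. \<omega> y - \<omega>p) x\<bar> \<le> C * \<delta> * exp (- s * x)" if x: "x > 0" for x
      proof -
        have "\<bar>(deriv ^^ k) (\<lambda>y. \<omega> y - \<omega>p) x\<bar> = \<bar>\<omega>b\<bar> * s ^ k * exp (- s * x)"
          using exp_solution_deriv_bound[OF reduce(3)[OF sol[unfolded \<open>\<omega>p = 0\<close>]] x s(1), of k] \<open>\<omega>p = 0\<close> by simp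
        also have "\<dots> = \<bar>\<omega>b\<bar> * s ^ k / \<delta> * \<delta> * exp (- s * x)" using delta by simp
        also have "\<dots> \<le> C * \<delta> * exp (- s * x)"
          using C(3) delta by (intro mult_right_mono) auto
        finally show ?thesis .
      qed
      ultimately show ?thesis using C(1) by blast
    qed
    then show ?thesis using s(1) by blast
  qed
  ultimately show ?thesis by blast
qed

end
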